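(* Let $p,q\in\mathbb{R}$ with $p\ge1$ and $0\le q<p$, let $Q\in\mathcal{S}_o^n$, and let $K_i\in\mathcal{K}_o^n$ for each $i=0,1,2,\dots$. If the sequence of measures $\{\widetilde{C}_{p,q}(K_i,Q,\cdot)\}_{i\ge1}$ converges weakly to $\widetilde{C}_{p,q}(K_0,Q,\cdot)$, then $\{K_i\}_{i\ge1}$ converges to $K_0$ in the Hausdorff metric.
   Context: $S^{n-1}$ is the unit sphere of $\mathbb{R}^n$ and $du$ is spherical Lebesgue measure. $\mathcal{K}_o^n$ is the set of convex bodies (compact convex sets with non-empty interior) in $\mathbb{R}^n$ containing the origin in their interiors. $\mathcal{S}_o^n$ is the set of star bodies (compact sets, star-shaped with respect to the origin, with continuous radial function) in $\mathbb{R}^n$ containing the origin in their interiors. The radial function is $\rho_Q(u)=\max\{\lambda\ge 0:\lambda u\in Q\}$, $u\in S^{n-1}$, and the support function is $h_K(v)=\max\{v\cdot x:x\in K\}$. For $K\in\mathcal{K}_o^n$ and a Borel set $\eta\subseteq S^{n-1}$, $\boldsymbol{\alpha}^*_K(\eta)$ is the set of $u\in S^{n-1}$ such that some $v\in\eta$ is an outer unit normal of $K$ at $\rho_K(u)u$, i.e. $\rho_K(u)u\cdot v=h_K(v)$. For $q\in\mathbb{R}$, $\widetilde{C}_q(K,Q,\eta)=\frac1n\int_{\boldsymbol{\alpha}^*_K(\eta)}\rho_K^q(u)\rho_Q^{n-q}(u)\,du$, and for $p,q\in\mathbb{R}$ the $L_p$ dual curvature measure is the Borel measure on $S^{n-1}$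 given by $d\widetilde{C}_{p,q}(K,Q,\cdot)=h_K^{-p}\,d\widetilde{C}_q(K,Q,\cdot)$. Weak convergence $\mu_i\to\mu$ of finite Borel measures on $S^{n-1}$ means $\int f\,d\mu_i\to\int f\,d\mu$ for every continuous $f:S^{n-1}\to\mathbb{R}$. The Hausdorff distance of $K,L\in\mathcal{K}_o^n$ is $\max_{u\in S^{n-1}}|h_K(u)-h_L(u)|$. *)

theory Defs
  imports "HOL-Analysis.Analysis"
begin

text \<open>Euclidean n-space is an arbitrary type of class \<^class>\<open>euclidean_space\<close> with
  n = \<open>DIM('a)\<close>.\<close>

definition convex_body :: "'a::euclidean_space set \<Rightarrow> bool" where
  "convex_body K \<longleftrightarrow> compact K \<and> convex K \<and> interior K \<noteq> {}"

definition convex_bodies_o :: "'a::euclidean_space set set" where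
  "convex_bodies_o = {K. convex_body K \<and> 0 \<in> interior K}"

text \<open>For compact \<open>Q\<close> containing the origin and \<open>u \<noteq> 0\<close> the supremum is attained, so this
  is the maximum of the \<open>\<lambda> \<ge> 0\<close> with \<open>\<lambda> u \<in> Q\<close>. The same holds for the maximum
  in the support function of a nonempty compact set.\<close>

definition radial_fun :: "'a::euclidean_space set \<Rightarrow> 'a \<Rightarrow> real" where
  "radial_fun Q u = Sup {l. 0 \<le> l \<and> l *\<^sub>R u \<in> Q}"

definition support_fun :: "'a::euclidean_space set \<Rightarrow> 'a \<Rightarrow> real" where
  "support_fun K v = (SUP x\<in>K. v \<bullet> x)"

definition star_body :: "'a::euclidean_space set \<Rightarrow> bool" where
  "star_body Q \<longleftrightarrow> compact Q \<and> (\<forall>x\<in>Q. closed_segment 0 x \<subseteq> Q)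
     \<and> continuous_on (sphere 0 1) (radial_fun Q)"

definition star_bodies_o :: "'a::euclidean_space set set" where
  "star_bodies_o = {Q. star_body Q \<and> 0 \<in> interior Q}"

abbreviation sphere_borel :: "'a::euclidean_space measure" where
  "sphere_borel \<equiv> restrict_space borel (sphere 0 1)"

text \<open>Spherical Lebesgue measure: the measure of a Borel set \<open>A\<close> of unit vectors is n times
  the volume of the cone \<open>{t u | 0 < t < 1, u \<in> A}\<close>. It is completed because
  the sets \<open>reverse_radial_gauss_image K \<eta>\<close> below are Lebesgue measurable, but need not be
  Borel, for Borel \<open>\<eta>\<close>.\<close>

definition sphere_lebesgue :: "'a::euclidean_space measure" where
  "sphere_lebesgue = completion
     (distr (scale_measure (of_nat DIM('a)) (restrict_space lborel (ball 0 1 - {0})))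
        sphere_borel (\<lambda>x::'a. x /\<^sub>R norm x))"

definition reverse_radial_gauss_image :: "'a::euclidean_space set \<Rightarrow> 'a set \<Rightarrow> 'a set" where
  "reverse_radial_gauss_image K \<eta> =
     {u \<in> sphere 0 1. \<exists>v\<in>\<eta>. (radial_fun K u *\<^sub>R u) \<bullet> v = support_fun K v}"

definition dual_curvature ::
    "real \<Rightarrow> 'a::euclidean_space set \<Rightarrow> 'a set \<Rightarrow> 'a set \<Rightarrow> ennreal" where
  "dual_curvature q K Q \<eta> = ennreal (1 / real DIM('a)) *
     (\<integral>\<^sup>+ u \<in> reverse_radial_gauss_image K \<eta>.
        ennreal (radial_fun K u powr q * radial_fun Q u powr (real DIM('a) - q)) \<partial>sphere_lebesgue)"

text \<open>The set function above is countably additive on the Borel sets for \<open>K\<close> in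
  \<^const>\<open>convex_bodies_o\<close> and \<open>Q\<close> in \<^const>\<open>star_bodies_o\<close>, because
  the radial directions of boundary points of \<open>K\<close> with more than one unit normal form a null set.
  Hence \<^const>\<open>measure_of\<close>, which gives the zero measure for a set function
  that is not countably additive, keeps its values.\<close>

definition dual_curvature_measure ::
    "real \<Rightarrow> 'a::euclidean_space set \<Rightarrow> 'a set \<Rightarrow> 'a measure" where
  "dual_curvature_measure q K Q =
     measure_of (sphere 0 1) (sets sphere_borel) (dual_curvature q K Q)"

definition Lp_dual_curvature_measure ::
    "real \<Rightarrow> real \<Rightarrow> 'a::euclidean_space set \<Rightarrow> 'a set \<Rightarrow> 'a measure" where
  "Lp_dual_curvature_measure p q K Q =
     density (dual_curvature_measure q K Q) (\<lambda>v. ennreal (support_fun K v powr (- p)))"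

definition sphere_weakly_converges ::
    "(nat \<Rightarrow> 'a::euclidean_space measure) \<Rightarrow> 'a measure \<Rightarrow> bool" where
  "sphere_weakly_converges M N \<longleftrightarrow>
     (\<forall>f::'a \<Rightarrow> real. continuous_on (sphere 0 1) f \<longrightarrow>
        (\<lambda>i. integral\<^sup>L (M i) f) \<longlonglongrightarrow> integral\<^sup>L N f)"

definition hausdorff_distance :: "'a::euclidean_space set \<Rightarrow> 'a set \<Rightarrow> real" where
  "hausdorff_distance K L = (SUP u\<in>sphere 0 1. \<bar>support_fun K u - support_fun L u\<bar>)"

end

theory Submission
  imports Defs "HOL-Complex_Analysis.Great_Picard"
begin

text \<open>Write \<open>\<mu>\<^sub>K\<close> for the \<open>L\<^sub>p\<close> dual curvature measure of \<open>K\<close> with parameters \<open>p\<close>, \<open>q\<close>, \<open>Q\<close>,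
  \<open>h\<^sub>K\<close> and \<open>\<rho>\<^sub>K\<close> for the support and radial functions, and \<open>\<nu>\<close> for the measure
  \<open>\<rho>\<^sub>Q\<^sup>n\<^sup>-\<^sup>q du / n\<close> on the sphere.

  Let \<open>\<alpha>\<^sub>K(u)\<close> be an outer unit normal of \<open>K\<close> at \<open>\<rho>\<^sub>K(u) u\<close>. For almost every \<open>u\<close> there is only
  one choice, so \<open>\<mu>\<^sub>K\<close> is the image under \<open>\<alpha>\<^sub>K\<close> of the measure \<open>\<rho>\<^sub>K\<^sup>q d\<nu>\<close>, weighted by \<open>h\<^sub>K\<^sup>-\<^sup>p\<close>
  (\<open>dual_curvature_measure_eq_distr\<close>). Since \<open>h\<^sub>K(\<alpha>\<^sub>K(u)) = \<rho>\<^sub>K(u) (u \<bullet> \<alpha>\<^sub>K(u))\<close> while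
  \<open>h\<^sub>L(v) \<ge> \<rho>\<^sub>L(u) (u \<bullet> v)\<close> for all \<open>v\<close>, the integral of \<open>h\<^sub>L\<^sup>p\<close> against \<open>\<mu>\<^sub>K\<close> is at least
  that of \<open>(\<rho>\<^sub>L / \<rho>\<^sub>K)\<^sup>p \<rho>\<^sub>K\<^sup>q\<close> against \<open>\<nu>\<close>, with equality for \<open>L = K\<close>. Adding this
  inequality to the one with \<open>K\<close> and \<open>L\<close> exchanged gives, with \<open>t = \<rho>\<^sub>L / \<rho>\<^sub>K\<close>,
  \[ \int \rho_K^q (t^p - 1)(1 - t^{q-p})\, d\nu \le
     \int h_L^p\, d(\mu_K - \mu_L) + \int h_K^p\, d(\mu_L - \mu_K), \]
  which is \<open>integral_ratio_gap_le\<close>. The integrand on the left is nonnegative and vanishes only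
  for \<open>t = 1\<close>, because \<open>p > 0\<close> and \<open>q < p\<close>. This is a quantitative form of uniqueness in the
  \<open>L\<^sub>p\<close> dual Minkowski problem.

  Now let \<open>K = K\<^sub>0\<close> and \<open>L = K\<^sub>i\<close>. The second term on the right tends to zero by weak convergence.
  So does the first, provided that the \<open>K\<^sub>i\<close> lie in one ball: then the functions \<open>h\<^sub>K\<^sub>i\<^sup>p\<close> are
  equicontinuous, and weak convergence is uniform on an equicontinuous bounded family
  (\<open>weak_convergence_equicontinuous\<close>). The common ball (\<open>weak_convergence_bounded\<close>) comes from
  comparing two powers of the circumradius \<open>R\<^sub>i\<close> of \<open>K\<^sub>i\<close> about the origin: the integral of
  \<open>h\<^sub>K\<^sub>i\<^sup>p\<close> against \<open>\<mu>\<^sub>K\<^sub>i\<close> is at most a constant times \<open>R\<^sub>i\<^sup>q\<close>, and for large \<open>i\<close> at least a positive constant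
  times \<open>R\<^sub>i\<^sup>p\<close>, since \<open>\<mu>\<^sub>K\<^sub>0\<close> is not concentrated in a closed hemisphere and \<open>\<mu>\<^sub>K\<^sub>i\<close> is close to it.

  Hence \<open>\<rho>\<^sub>K\<^sub>i / \<rho>\<^sub>K\<^sub>0\<close> tends to 1 in measure. Convexity improves this to uniform convergence of
  the support functions: if \<open>h\<^sub>K\<^sub>i(v)\<close> differs from \<open>h\<^sub>K\<^sub>0(v)\<close> by a fixed factor, then the ratio of
  the radial functions is bounded away from 1 in all directions of some ball of fixed radius
  and bounded centre, and those directions have measure bounded below.\<close>

section \<open>Support and radial functions\<close>

lemma support_fun_ge:
  fixes K :: "'a::euclidean_space set"
  assumes "bounded K" "x \<in> K"
  shows "v \<bullet> x \<le> support_fun K v"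
proof -
  have "bounded ((\<lambda>x. v \<bullet> x) ` K)"
    using assms(1) by (rule bounded_linear_image) (rule bounded_linear_inner_right)
  then show ?thesis
    unfolding support_fun_def using assms(2) by (intro cSUP_upper bounded_imp_bdd_above)
qed

lemma support_fun_le:
  fixes K :: "'a::euclidean_space set"
  assumes "K \<noteq> {}" "\<And>x. x \<in> K \<Longrightarrow> v \<bullet> x \<le> c"
  shows "support_fun K v \<le> c"
  unfolding support_fun_def using assms by (intro cSUP_least)

lemma support_fun_attained:
  fixes K :: "'a::euclidean_space set"
  assumes "compact K" "K \<noteq> {}"
  obtains x where "x \<in> K" "support_fun K v = v \<bullet> x"
proof -
  obtain x where x: "x \<in> K" "\<And>y. y \<in> K \<Longrightarrow> v \<bullet> y \<le> v \<bullet> x"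
    using continuous_attains_sup[OF assms, of "\<lambda>y. v \<bullet> y"]
      continuous_on_inner[OF continuous_on_const continuous_on_id] by blast
  have "support_fun K v = v \<bullet> x"
    using x support_fun_le[of K v] support_fun_ge[of K x v] assms
    by (intro antisym) (auto simp: compact_imp_bounded)
  with x that show thesis by blast
qed

lemma support_fun_lipschitz:
  fixes K :: "'a::euclidean_space set"
  assumes "K \<subseteq> cball 0 R" "K \<noteq> {}"
  shows "\<bar>support_fun K v - support_fun K w\<bar> \<le> R * norm (v - w)"
proof -
  have bK: "bounded K" using assms(1) bounded_cball bounded_subset by blast
  have *: "support_fun K v \<le> support_fun K w + R * norm (v - w)" for v w
  proof (rule support_fun_le[OF assms(2)])
    fix x assume x: "x \<in> K"
    have "v \<bullet> x = w \<bullet> x + (v - w) \<bullet> x" by (simp add: inner_diff_left)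
    also have "(v - w) \<bullet> x \<le> norm (v - w) * norm x" by (rule norm_cauchy_schwarz)
    also have "\<dots> \<le> norm (v - w) * R" using x assms(1) by (intro mult_left_mono) auto
    also have "w \<bullet> x \<le> support_fun K w" by (rule support_fun_ge[OF bK x])
    finally show "v \<bullet> x \<le> support_fun K w + R * norm (v - w)" by (simp add: mult.commute)
  qed
  show ?thesis using *[of v w] *[of w v] by (simp add: norm_minus_commute abs_le_iff)
qed

lemma support_fun_continuous:
  fixes K :: "'a::euclidean_space set"
  assumes "bounded K" "K \<noteq> {}"
  shows "continuous_on S (support_fun K)"
proof -
  obtain R where R: "0 < R" "K \<subseteq> cball 0 R"
    using assms(1) by (auto simp: bounded_pos subset_iff)
  have "R-lipschitz_on S (support_fun K)"
    using support_fun_lipschitz[OF R(2) assms(2)] R(1)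
    by (intro lipschitz_onI) (auto simp: dist_norm)
  then show ?thesis by (rule lipschitz_on_continuous_on)
qed

lemma support_fun_upper:
  fixes K :: "'a::euclidean_space set"
  assumes "K \<subseteq> cball 0 R" "K \<noteq> {}"
  shows "support_fun K v \<le> R * norm v"
proof (rule support_fun_le[OF assms(2)])
  fix x assume "x \<in> K"
  then have "norm x \<le> R" using assms(1) by auto
  then show "v \<bullet> x \<le> R * norm v"
    using norm_cauchy_schwarz[of v x] mult_left_mono[of "norm x" R "norm v"]
    by (simp add: mult.commute)
qed

lemma support_fun_lower:
  fixes K :: "'a::euclidean_space set"
  assumes "cball 0 r \<subseteq> K" "bounded K" "0 \<le> r"
  shows "r * norm v \<le> support_fun K v"
proof -
  have "(r / norm v) *\<^sub>R v \<in> K" using assms(1,3) by (cases "v = 0") auto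
  from support_fun_ge[OF assms(2) this, of v] show ?thesis
    by (cases "v = 0") (simp_all add: dot_square_norm power2_eq_square field_simps)
qed

lemma radial_fun_mem_upper:
  fixes Q :: "'a::euclidean_space set"
  assumes "compact Q" "0 \<in> Q" "u \<noteq> 0"
  shows radial_fun_mem: "radial_fun Q u *\<^sub>R u \<in> Q"
    and radial_fun_upper: "\<And>l. 0 \<le> l \<Longrightarrow> l *\<^sub>R u \<in> Q \<Longrightarrow> l \<le> radial_fun Q u"
    and radial_fun_nonneg: "0 \<le> radial_fun Q u"
proof -
  let ?A = "{l. 0 \<le> l \<and> l *\<^sub>R u \<in> Q}"
  obtain R where R: "\<And>x. x \<in> Q \<Longrightarrow> norm x \<le> R"
    using compact_imp_bounded[OF assms(1)] by (auto simp: bounded_iff)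
  have bdd: "bdd_above ?A"
  proof (rule bdd_aboveI)
    fix l assume "l \<in> ?A"
    then have "l * norm u \<le> R" using R[of "l *\<^sub>R u"] by auto
    then show "l \<le> R / norm u" using assms(3) by (simp add: field_simps)
  qed
  have ne: "0 \<in> ?A" using assms(2) by simp
  have "closed ({0..} \<inter> (\<lambda>l. l *\<^sub>R u) -` Q)"
    using assms(1) by (intro closed_Int closed_vimage compact_imp_closed continuous_intros) auto
  then have "closed ?A" by (simp add: vimage_def Int_def)
  with bdd ne have "Sup ?A \<in> ?A" by (intro closed_contains_Sup) auto
  then show "radial_fun Q u *\<^sub>R u \<in> Q" "0 \<le> radial_fun Q u" by (auto simp: radial_fun_def)
  show "\<And>l. 0 \<le> l \<Longrightarrow> l *\<^sub>R u \<in> Q \<Longrightarrow> l \<le> radial_fun Q u"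
    unfolding radial_fun_def using bdd by (intro cSup_upper) auto
qed

lemma convex_bodies_oD:
  assumes "K \<in> convex_bodies_o"
  shows "compact K" "convex K" "bounded K" "0 \<in> K" "K \<noteq> {}"
  using assms interior_subset[of K]
  by (auto simp: convex_bodies_o_def convex_body_def compact_imp_bounded)

lemma contains_small_cball:
  fixes K :: "'a::euclidean_space set"
  assumes "0 \<in> interior K"
  obtains r where "0 < r" "cball 0 r \<subseteq> K"
  using assms mem_interior_cball by blast

lemma inside_large_cball:
  fixes K :: "'a::euclidean_space set"
  assumes "bounded K"
  obtains R where "0 < R" "K \<subseteq> cball 0 R"
  using assms by (auto simp: bounded_pos subset_iff)

lemma convex_bodies_o_radii:
  fixes K :: "'a::euclidean_space set"
  assumes "K \<in> convex_bodies_o"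
  obtains r R where "0 < r" "r \<le> R" "cball 0 r \<subseteq> K" "K \<subseteq> cball 0 R"
proof -
  obtain r where r: "0 < r" "cball 0 r \<subseteq> K"
    using assms contains_small_cball by (auto simp: convex_bodies_o_def)
  obtain R where R: "0 < R" "K \<subseteq> cball 0 R"
    using inside_large_cball[OF convex_bodies_oD(3)[OF assms]] .
  show thesis
    by (rule that[of r "max r R"]) (use r R in auto)
qed

lemma radial_fun_lower_bound:
  fixes K :: "'a::euclidean_space set"
  assumes "cball 0 r \<subseteq> K" "0 \<le> r" "compact K" "norm u = 1"
  shows "r \<le> radial_fun K u"
proof (rule radial_fun_upper)
  show "r *\<^sub>R u \<in> K" "0 \<in> K" using assms by (auto simp: subset_iff)
qed (use assms in auto)

lemma radial_fun_upper_bound: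
  fixes K :: "'a::euclidean_space set"
  assumes "K \<subseteq> cball 0 R" "0 \<in> K" "compact K" "norm u = 1"
  shows "radial_fun K u \<le> R"
proof -
  have "radial_fun K u *\<^sub>R u \<in> K" by (rule radial_fun_mem) (use assms in auto)
  then show ?thesis using assms by auto
qed

lemma radial_fun_pos:
  fixes K :: "'a::euclidean_space set"
  assumes "0 \<in> interior K" "compact K" "norm u = 1"
  shows "0 < radial_fun K u"
proof -
  obtain r where "0 < r" "cball 0 r \<subseteq> K" using contains_small_cball[OF assms(1)] .
  then show ?thesis using radial_fun_lower_bound[of r K u] assms by auto
qed

lemma support_fun_pos:
  fixes K :: "'a::euclidean_space set"
  assumes "K \<in> convex_bodies_o" "norm v = 1"
  shows "0 < support_fun K v"
proof -
  obtain r R where "0 < r" "r \<le> R" "cball 0 r \<subseteq> K" "K \<subseteq> cball 0 R"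
    using convex_bodies_o_radii[OF assms(1)] .
  then show ?thesis
    using support_fun_lower[of r K v] convex_bodies_oD[OF assms(1)] assms(2) by auto
qed

lemma radial_inner_le_support:
  fixes K :: "'a::euclidean_space set"
  assumes "K \<in> convex_bodies_o" "norm u = 1"
  shows "radial_fun K u * (u \<bullet> v) \<le> support_fun K v"
proof -
  have "radial_fun K u *\<^sub>R u \<in> K"
    by (rule radial_fun_mem) (use assms convex_bodies_oD[OF assms(1)] in auto)
  from support_fun_ge[OF convex_bodies_oD(3)[OF assms(1)] this, of v]
  show ?thesis by (simp add: inner_commute)
qed

text \<open>The point \<open>\<rho>\<^sub>K(u) u\<close> is not interior, since otherwise the ray could be prolonged within \<open>K\<close>;
  a supporting hyperplane there supplies the normal.\<close>

lemma radial_point_has_normal: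
  fixes K :: "'a::euclidean_space set"
  assumes K: "K \<in> convex_bodies_o" and u: "norm u = 1"
  obtains v where "norm v = 1" "radial_fun K u * (u \<bullet> v) = support_fun K v"
proof -
  note KD = convex_bodies_oD[OF K]
  let ?x = "radial_fun K u *\<^sub>R u"
  have u0: "u \<noteq> 0" using u by auto
  have xK: "?x \<in> K" using radial_fun_mem[OF KD(1,4) u0] .
  have int: "interior K \<noteq> {}" "0 \<in> interior K" using K by (auto simp: convex_bodies_o_def)
  have "?x \<notin> interior K"
  proof
    assume "?x \<in> interior K"
    then obtain e where e: "0 < e" "cball ?x e \<subseteq> K" by (meson mem_interior_cball)
    have "?x + e *\<^sub>R u \<in> K" using e u by (auto simp: subset_iff dist_norm)
    then have "(radial_fun K u + e) *\<^sub>R u \<in> K" by (simp add: algebra_simps)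
    then have "radial_fun K u + e \<le> radial_fun K u"
      using radial_fun_nonneg[OF KD(1,4) u0] e(1)
      by (intro radial_fun_upper[OF KD(1,4) u0]) auto
    then show False using e by simp
  qed
  then have "?x \<notin> rel_interior K"
    using int rel_interior_nonempty_interior by blast
  then obtain a where a: "a \<noteq> 0" "\<And>y. y \<in> K \<Longrightarrow> a \<bullet> ?x \<le> a \<bullet> y"
    using supporting_hyperplane_rel_boundary[OF KD(2) xK] by metis
  define v where "v = - a /\<^sub>R norm a"
  have nv: "norm v = 1" using a by (simp add: v_def)
  have "v \<bullet> y \<le> v \<bullet> ?x" if "y \<in> K" for y
    using a(1) a(2)[OF that] by (auto simp: v_def intro!: mult_left_mono)
  then have "support_fun K v \<le> v \<bullet> ?x" by (rule support_fun_le[OF KD(5)])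
  with support_fun_ge[OF KD(3) xK, of v] nv that show thesis
    by (simp add: inner_commute)
qed

text \<open>The boundary of the polar body of \<open>K\<close>. Its support function is the gauge of \<open>K\<close>. It turns questions about normals of \<open>K\<close> into
  questions about maximizers of linear functionals.\<close>

definition scaled_normals :: "'a::euclidean_space set \<Rightarrow> 'a set" where
  "scaled_normals K = (\<lambda>v. v /\<^sub>R support_fun K v) ` sphere 0 1"

lemma scaled_normals_bounded:
  fixes K :: "'a::euclidean_space set"
  assumes "K \<in> convex_bodies_o"
  shows "bounded (scaled_normals K)"
proof -
  have "continuous_on (sphere 0 1) (\<lambda>v. v /\<^sub>R support_fun K v)"
    using support_fun_pos[OF assms] support_fun_continuous[of K] convex_bodies_oD[OF assms]
    by (intro continuous_intros) (auto simp: less_imp_neq[symmetric])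
  then show ?thesis unfolding scaled_normals_def
    by (intro compact_imp_bounded compact_continuous_image) auto
qed

lemma scaled_normals_nonempty: "scaled_normals (K :: 'a::euclidean_space set) \<noteq> {}"
  by (simp add: scaled_normals_def)

text \<open>Each scaled normal has inner product at most 1 with the boundary point \<open>\<rho>\<^sub>K(u) u\<close> of \<open>K\<close>, and the
  normals at that point are those for which the value 1 is reached.\<close>

lemma normal_maximizes_over_scaled_normals:
  fixes K :: "'a::euclidean_space set"
  assumes K: "K \<in> convex_bodies_o" and "norm u = 1" "norm v = 1"
    and eq: "radial_fun K u * (u \<bullet> v) = support_fun K v" and w: "w \<in> scaled_normals K"
  shows "w \<bullet> u \<le> (v /\<^sub>R support_fun K v) \<bullet> u" 
    and "(v /\<^sub>R support_fun K v) \<bullet> u = 1 / radial_fun K u"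
proof -
  have rho: "0 < radial_fun K u"
    using radial_fun_pos assms(2) K convex_bodies_oD[OF K] by (auto simp: convex_bodies_o_def)
  show *: "(v /\<^sub>R support_fun K v) \<bullet> u = 1 / radial_fun K u"
    using eq[symmetric] rho support_fun_pos[OF K assms(3)]
    by (auto simp: field_simps inner_commute)
  obtain z where z: "norm z = 1" "w = z /\<^sub>R support_fun K z"
    using w by (auto simp: scaled_normals_def)
  have "radial_fun K u * (u \<bullet> z) \<le> support_fun K z"
    by (rule radial_inner_le_support[OF K assms(2)])
  then show "w \<bullet> u \<le> (v /\<^sub>R support_fun K v) \<bullet> u"
    using rho support_fun_pos[OF K z(1)] unfolding * z(2)
    by (simp add: field_simps inner_commute)
qed

lemma radial_fun_eq_inverse_support:
  fixes K :: "'a::euclidean_space set"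
  assumes K: "K \<in> convex_bodies_o" and "norm u = 1"
  shows "radial_fun K u = 1 / support_fun (scaled_normals K) u"
proof -
  obtain v where v: "norm v = 1" "radial_fun K u * (u \<bullet> v) = support_fun K v"
    using radial_point_has_normal[OF assms] .
  have mem: "v /\<^sub>R support_fun K v \<in> scaled_normals K" using v(1) by (auto simp: scaled_normals_def)
  note * = normal_maximizes_over_scaled_normals[OF K assms(2) v]
  have "support_fun (scaled_normals K) u = (v /\<^sub>R support_fun K v) \<bullet> u"
  proof (rule antisym)
    show "support_fun (scaled_normals K) u \<le> (v /\<^sub>R support_fun K v) \<bullet> u"
      using *(1) by (intro support_fun_le scaled_normals_nonempty) (simp add: inner_commute)
    show "(v /\<^sub>R support_fun K v) \<bullet> u \<le> support_fun (scaled_normals K) u"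
      using support_fun_ge[OF scaled_normals_bounded[OF K] mem, of u] by (simp add: inner_commute)
  qed
  with *(2)[OF mem] show ?thesis by simp
qed

text \<open>The reciprocal of \<open>\<rho>\<^sub>K\<close> is a support function and therefore Lipschitz.\<close>

lemma radial_fun_continuous:
  fixes K :: "'a::euclidean_space set"
  assumes K: "K \<in> convex_bodies_o"
  shows "continuous_on (sphere 0 1) (radial_fun K)"
proof -
  have pos: "0 < radial_fun K u" if "norm u = 1" for u
    using radial_fun_pos that K convex_bodies_oD[OF K] by (auto simp: convex_bodies_o_def)
  have "continuous_on (sphere 0 1) (\<lambda>u. 1 / support_fun (scaled_normals K) u)"
    using pos radial_fun_eq_inverse_support[OF K]
      support_fun_continuous[OF scaled_normals_bounded[OF K] scaled_normals_nonempty]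
    by (intro continuous_intros) force+
  then show ?thesis
    using radial_fun_eq_inverse_support[OF K] by (simp cong: continuous_on_cong_simp)
qed


section \<open>Almost every direction has a unique maximizer\<close>

lemma lborel_integral_translate:
  fixes f :: "'a::euclidean_space \<Rightarrow> real"
  assumes [measurable]: "f \<in> borel_measurable borel"
  shows "(\<integral>x. f (x + c) \<partial>lborel) = (\<integral>x. f x \<partial>lborel)"
proof -
  have "(\<integral>x. f x \<partial>lborel) = (\<integral>x. f x \<partial>distr lborel borel ((+) c))"
    by (simp add: lborel_distr_plus)
  also have "\<dots> = (\<integral>x. f (x + c) \<partial>lborel)"
    by (subst integral_distr) (auto simp: add.commute)
  finally show ?thesis ..
qed

lemma integrable_compact_support:
  fixes f :: "'a::euclidean_space \<Rightarrow> real"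
  assumes "continuous_on UNIV f" "\<And>x. x \<notin> cball 0 r \<Longrightarrow> f x = 0"
  shows "integrable lborel f"
proof -
  have "integrable lborel (\<lambda>x. indicator (cball 0 r) x *\<^sub>R f x)"
    by (rule borel_integrable_compact) (use assms(1) continuous_on_subset in auto)
  also have "(\<lambda>x. indicator (cball 0 r) x *\<^sub>R f x) = f"
  proof
    show "indicator (cball 0 r) x *\<^sub>R f x = f x" for x
      using assms(2)[of x] by (cases "x \<in> cball 0 r") (auto simp: indicator_def)
  qed
  finally show ?thesis .
qed

text \<open>Points at which the graph of a convex \<open>g\<close> has a kink along \<open>b\<close>: the two one-sided slopes differ
  by at least \<open>\<epsilon>\<close>. Second differences at all scales replace the slopes, so that the set is
  visibly closed.\<close>

definition ridge :: "('a::euclidean_space \<Rightarrow> real) \<Rightarrow> 'a \<Rightarrow> real \<Rightarrow> 'a set" where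
  "ridge g b \<epsilon> = {x. \<forall>t>0. t * \<epsilon> \<le> g (x + t *\<^sub>R b) - 2 * g x + g (x - t *\<^sub>R b)}"

lemma closed_ridge:
  assumes "continuous_on UNIV g"
  shows "closed (ridge g b \<epsilon>)"
proof -
  have [continuous_intros]: "continuous_on UNIV (\<lambda>x. g (f x))" if "continuous_on UNIV f"
    for f :: "'a \<Rightarrow> 'a" using continuous_on_compose2[OF assms that] by auto
  have "ridge g b \<epsilon> = (\<Inter>t\<in>{0<..}. {x. t * \<epsilon> \<le> g (x + t *\<^sub>R b) - 2 * g x + g (x - t *\<^sub>R b)})"
    by (auto simp: ridge_def)
  also have "closed \<dots>"
    by (intro closed_INT ballI closed_Collect_le continuous_intros)
  finally show ?thesis .
qed

text \<open>Integrate the second difference of \<open>g\<close> with step \<open>t b\<close> against a Lipschitz bump \<open>\<phi>\<close>. It is the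
  increment of the first difference \<open>d\<close>, which has size \<open>O(t)\<close>; translation invariance of Lebesgue
  measure moves the increment to \<open>\<phi>\<close>, which gives another factor \<open>t\<close>. The integral is thus
  \<open>O(t\<^sup>2)\<close>, whereas it is at least \<open>t \<epsilon>\<close> times the \<open>\<phi>\<close>-mass of the ridge. Let \<open>t\<close> tend to zero.
  This takes the place of differentiability almost everywhere of convex functions.\<close>

lemma ridge_null:
  fixes g :: "'a::euclidean_space \<Rightarrow> real"
  assumes lip: "L-lipschitz_on UNIV g"
    and conv: "\<And>x y. 2 * g x \<le> g (x + y) + g (x - y)"
    and b: "norm b = 1" and e: "\<epsilon> > 0"
  shows "ridge g b \<epsilon> \<in> null_sets lborel"
proof -
  let ?E = "ridge g b \<epsilon>"
  have gc: "continuous_on UNIV g" by (rule lipschitz_on_continuous_on[OF lip])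
  have [continuous_intros]: "continuous_on UNIV (\<lambda>x. g (f x))" if "continuous_on UNIV f"
    for f :: "'a \<Rightarrow> 'a" using continuous_on_compose2[OF gc that] by auto
  have Em[measurable]: "?E \<in> sets borel" using closed_ridge[OF gc] by (rule borel_closed)
  have gm[measurable]: "g \<in> borel_measurable borel"
    using gc by (rule borel_measurable_continuous_onI)
  have L0: "0 \<le> L" using lip by (rule lipschitz_on_nonneg)
  have "AE x in lborel. x \<notin> ?E \<or> real R \<le> norm x" for R :: nat
  proof -
    \<comment> \<open>A 1-Lipschitz bump; its translates by at most 1 are supported in C.\<close>
    define \<phi> where "\<phi> = (\<lambda>x::'a. max 0 (real R - norm x))"
    define C where "C = cball (0::'a) (real R + 1)"
    have \<phi>c[continuous_intros]: "continuous_on UNIV (\<lambda>x. \<phi> (f x))" if "continuous_on UNIV f"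
      for f :: "'a \<Rightarrow> 'a" unfolding \<phi>_def by (intro continuous_intros that)
    have [measurable]: "\<phi> \<in> borel_measurable borel" unfolding \<phi>_def by measurable
    have \<phi>0: "0 \<le> \<phi> x" for x by (simp add: \<phi>_def)
    have ind_int: "integrable lborel (\<lambda>x. indicator C x :: real)"
      unfolding C_def by (intro integrable_real_indicator emeasure_lborel_cball_finite) auto
    have \<phi>int: "integrable lborel \<phi>"
      by (rule integrable_compact_support[where r = "real R"]) (auto simp: \<phi>_def intro!: continuous_intros)
    have \<phi>Eint: "integrable lborel (\<lambda>x. \<phi> x * indicator ?E x)"
      by (rule Bochner_Integration.integrable_bound[OF \<phi>int]) (auto simp: indicator_def \<phi>0)
    have bound: "\<epsilon> * (\<integral>x. \<phi> x * indicator ?E x \<partial>lborel) \<le> t * (L * measure lborel C)"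
      if t: "0 < t" "t \<le> 1" for t
    proof -
      define d where "d = (\<lambda>x. g x - g (x - t *\<^sub>R b))"
      have dc[continuous_intros]: "continuous_on UNIV (\<lambda>x. d (f x))" if "continuous_on UNIV f"
        for f :: "'a \<Rightarrow> 'a" unfolding d_def by (intro continuous_intros that)
      have [measurable]: "d \<in> borel_measurable borel" unfolding d_def by measurable
      have d_le: "\<bar>d x\<bar> \<le> L * t" for x
        using lipschitz_onD[OF lip, of x "x - t *\<^sub>R b"] b t by (simp add: d_def dist_norm)
      have i1: "integrable lborel (\<lambda>x. \<phi> x * d (x + t *\<^sub>R b))"
        by (rule integrable_compact_support[where r = "real R"])
          (auto simp: \<phi>_def intro!: continuous_intros)
      have i2: "integrable lborel (\<lambda>x. \<phi> x * d x)"
        by (rule integrable_compact_support[where r = "real R"])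
          (auto simp: \<phi>_def intro!: continuous_intros)
      have i3: "integrable lborel (\<lambda>x. \<phi> (x - t *\<^sub>R b) * d x)"
      proof (rule integrable_compact_support[where r = "real R + 1"])
        fix x :: 'a assume "x \<notin> cball 0 (real R + 1)"
        then have "real R \<le> norm (x - t *\<^sub>R b)"
          using norm_triangle_ineq2[of x "t *\<^sub>R b"] b t by simp
        then show "\<phi> (x - t *\<^sub>R b) * d x = 0" by (simp add: \<phi>_def)
      qed (intro continuous_intros)
      have "(\<integral>x. t * \<epsilon> * (\<phi> x * indicator ?E x) \<partial>lborel) \<le>
          (\<integral>x. \<phi> x * d (x + t *\<^sub>R b) - \<phi> x * d x \<partial>lborel)"
      proof (intro integral_mono Bochner_Integration.integrable_diff integrable_mult_right \<phi>Eint i1 i2)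
        fix x :: 'a
        have "t * \<epsilon> * indicator ?E x \<le> d (x + t *\<^sub>R b) - d x"
          using conv[of x "t *\<^sub>R b"] t by (auto simp: indicator_def d_def ridge_def)
        from mult_left_mono[OF this \<phi>0[of x]]
        show "t * \<epsilon> * (\<phi> x * indicator ?E x) \<le> \<phi> x * d (x + t *\<^sub>R b) - \<phi> x * d x"
          by (simp add: algebra_simps)
      qed
      also have "\<dots> = (\<integral>x. \<phi> x * d (x + t *\<^sub>R b) \<partial>lborel) - (\<integral>x. \<phi> x * d x \<partial>lborel)"
        by (rule Bochner_Integration.integral_diff[OF i1 i2])
      also have "(\<integral>x. \<phi> x * d (x + t *\<^sub>R b) \<partial>lborel) = (\<integral>x. \<phi> (x - t *\<^sub>R b) * d x \<partial>lborel)"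
        using lborel_integral_translate[of "\<lambda>x. \<phi> (x - t *\<^sub>R b) * d x" "t *\<^sub>R b"] by simp
      also have "\<dots> - (\<integral>x. \<phi> x * d x \<partial>lborel) = (\<integral>x. \<phi> (x - t *\<^sub>R b) * d x - \<phi> x * d x \<partial>lborel)"
        by (rule Bochner_Integration.integral_diff[OF i3 i2, symmetric])
      also have "\<dots> \<le> (\<integral>x. (t * (L * t)) * indicator C x \<partial>lborel)"
      proof (intro integral_mono Bochner_Integration.integrable_diff integrable_mult_right ind_int i3 i2)
        fix x :: 'a
        show "\<phi> (x - t *\<^sub>R b) * d x - \<phi> x * d x \<le> (t * (L * t)) * indicator C x"
        proof (cases "x \<in> C")
          case True
          have "\<bar>norm (x - t *\<^sub>R b) - norm x\<bar> \<le> t"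
            using norm_triangle_ineq3[of "x - t *\<^sub>R b" x] b t by simp
          then have "\<bar>\<phi> (x - t *\<^sub>R b) - \<phi> x\<bar> \<le> t" by (auto simp: \<phi>_def)
          then have "\<bar>(\<phi> (x - t *\<^sub>R b) - \<phi> x) * d x\<bar> \<le> t * (L * t)"
            unfolding abs_mult using d_le[of x] t by (intro mult_mono) auto
          then show ?thesis using True by (simp add: algebra_simps)
        next
          case False
          then have "real R \<le> norm (x - t *\<^sub>R b)" "real R \<le> norm x"
            using norm_triangle_ineq2[of x "t *\<^sub>R b"] b t by (simp_all add: C_def)
          then show ?thesis using False by (simp add: \<phi>_def)
        qed
      qed
      also have "\<dots> = t * (t * (L * measure lborel C))"
        by (simp add: C_def)
      finally have "t * (\<epsilon> * (\<integral>x. \<phi> x * indicator ?E x \<partial>lborel)) \<le> t * (t * (L * measure lborel C))"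
        by (simp add: mult.assoc)
      then show ?thesis using t by simp
    qed
    have "((\<lambda>t. t * (L * measure lborel C)) \<longlongrightarrow> 0 * (L * measure lborel C)) (at_right 0)"
      by (intro tendsto_intros)
    then have "\<epsilon> * (\<integral>x. \<phi> x * indicator ?E x \<partial>lborel) \<le> 0 * (L * measure lborel C)"
    proof (rule tendsto_lowerbound)
      show "\<forall>\<^sub>F t in at_right 0. \<epsilon> * (\<integral>x. \<phi> x * indicator ?E x \<partial>lborel) \<le> t * (L * measure lborel C)"
        unfolding eventually_at_right_field using bound by (intro exI[of _ 1]) auto
    qed simp
    then have "(\<integral>x. \<phi> x * indicator ?E x \<partial>lborel) \<le> 0" using e by (simp add: mult_le_0_iff)
    moreover have "0 \<le> (\<integral>x. \<phi> x * indicator ?E x \<partial>lborel)" using \<phi>0 by simp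
    ultimately have "(\<integral>x. \<phi> x * indicator ?E x \<partial>lborel) = 0" by simp
    then have "AE x in lborel. \<phi> x * indicator ?E x = 0"
      using \<phi>0 by (subst (asm) integral_nonneg_eq_0_iff_AE[OF \<phi>Eint]) auto
    then show ?thesis
    proof eventually_elim
      case (elim x)
      then show ?case by (auto simp: \<phi>_def indicator_def max_def split: if_splits)
    qed
  qed
  then have "AE x in lborel. \<forall>R::nat. x \<notin> ?E \<or> real R \<le> norm x"
    unfolding AE_all_countable by blast
  then have "AE x in lborel. x \<notin> ?E"
  proof eventually_elim
    case (elim x)
    obtain n :: nat where "norm x < real n" using reals_Archimedean2 by blast
    with elim show ?case by (metis not_le)
  qed
  then show ?thesis by (simp add: AE_iff_null_sets)
qed

text \<open>A null set containing every point at which two elements of \<open>W\<close> maximize the inner product. It is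
  defined by kinks of the support function along the coordinate directions, which makes it a Borel
  set, and a cone.\<close>

definition crease :: "'a::euclidean_space set \<Rightarrow> 'a set" where
  "crease W = (\<Union>b\<in>Basis. \<Union>k::nat. ridge (support_fun W) b (1 / real (Suc k)))"

lemma crease_null:
  fixes W :: "'a::euclidean_space set"
  assumes "bounded W" "W \<noteq> {}"
  shows "crease W \<in> null_sets lborel"
proof -
  obtain R where R: "0 < R" "W \<subseteq> cball 0 R" using inside_large_cball[OF assms(1)] .
  have lip: "R-lipschitz_on UNIV (support_fun W)"
    using support_fun_lipschitz[OF R(2) assms(2)] R(1)
    by (intro lipschitz_onI) (auto simp: dist_norm)
  have conv: "2 * support_fun W x \<le> support_fun W (x + y) + support_fun W (x - y)" for x y
  proof -
    have "support_fun W x \<le> (support_fun W (x + y) + support_fun W (x - y)) / 2"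
    proof (rule support_fun_le[OF assms(2)])
      fix w assume "w \<in> W"
      from support_fun_ge[OF assms(1) this, of "x + y"] support_fun_ge[OF assms(1) this, of "x - y"]
      show "x \<bullet> w \<le> (support_fun W (x + y) + support_fun W (x - y)) / 2"
        by (simp add: inner_add_left inner_diff_left)
    qed
    then show ?thesis by simp
  qed
  show ?thesis unfolding crease_def
    by (intro null_sets_UN' countable_UN ridge_null[OF lip conv]) (auto simp: countable_finite)
qed

text \<open>Maximizers \<open>w1\<close>, \<open>w2\<close> at \<open>x\<close> are subgradients of the support function there. If they differ in
  the coordinate \<open>b\<close>, then following \<open>w2\<close> forwards and \<open>w1\<close> backwards along \<open>b\<close> exhibits a kink.\<close>

lemma unique_maximizer_off_crease:
  fixes W :: "'a::euclidean_space set"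
  assumes bd: "bounded W" and x: "x \<notin> crease W"
    and w: "w1 \<in> W" "w2 \<in> W"
    and max: "\<And>w. w \<in> W \<Longrightarrow> w \<bullet> x \<le> w1 \<bullet> x" "\<And>w. w \<in> W \<Longrightarrow> w \<bullet> x \<le> w2 \<bullet> x"
  shows "w1 = w2"
proof -
  have *: False if w: "w1 \<in> W" "w2 \<in> W" and b: "b \<in> Basis" "w1 \<bullet> b < w2 \<bullet> b"
    and max: "\<And>w. w \<in> W \<Longrightarrow> w \<bullet> x \<le> w1 \<bullet> x" "\<And>w. w \<in> W \<Longrightarrow> w \<bullet> x \<le> w2 \<bullet> x"
    for w1 w2 b
  proof -
    have eq: "w1 \<bullet> x = w2 \<bullet> x" using max w by (meson antisym)
    have g: "support_fun W x \<le> w1 \<bullet> x"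
      using w max by (intro support_fun_le) (auto simp: inner_commute)
    obtain k :: nat where k: "1 / real (Suc k) < w2 \<bullet> b - w1 \<bullet> b"
      using nat_approx_posE[of "w2 \<bullet> b - w1 \<bullet> b"] b by auto
    have "x \<in> ridge (support_fun W) b (1 / real (Suc k))"
      unfolding ridge_def
    proof safe
      fix t :: real assume t: "0 < t"
      have "t * (1 / real (Suc k)) \<le> t * (w2 \<bullet> b - w1 \<bullet> b)"
        using k t by (intro mult_left_mono) auto
      with g eq support_fun_ge[OF bd w(2), of "x + t *\<^sub>R b"] support_fun_ge[OF bd w(1), of "x - t *\<^sub>R b"]
      show "t * (1 / real (Suc k)) \<le> support_fun W (x + t *\<^sub>R b) - 2 * support_fun W x + support_fun W (x - t *\<^sub>R b)"
        by (simp add: inner_commute algebra_simps)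
    qed
    then show False using x b(1) by (auto simp: crease_def)
  qed
  show ?thesis
  proof (rule euclidean_eqI)
    fix b :: 'a assume b: "b \<in> Basis"
    show "w1 \<bullet> b = w2 \<bullet> b"
      using *[OF w b _ max] *[OF w(2,1) b _ max(2,1)] by force
  qed
qed

lemma support_fun_scale:
  fixes K :: "'a::euclidean_space set"
  assumes "bounded K" "K \<noteq> {}" "0 < s"
  shows "support_fun K (s *\<^sub>R v) = s * support_fun K v"
proof -
  have *: "support_fun K (s *\<^sub>R v) \<le> s * support_fun K v" if "0 < s" for s v
    using support_fun_ge[OF assms(1), of _ v] that
    by (intro support_fun_le[OF assms(2)]) (simp add: mult_left_mono)
  from *[of s v] *[of "1/s" "s *\<^sub>R v"] assms(3) show ?thesis
    by (intro antisym) (auto simp: field_simps)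
qed

lemma crease_scale:
  fixes W :: "'a::euclidean_space set"
  assumes W: "bounded W" "W \<noteq> {}" and s: "0 < s" and x: "s *\<^sub>R x \<in> crease W"
  shows "x \<in> crease W"
proof -
  have "x \<in> ridge (support_fun W) b e" if "s *\<^sub>R x \<in> ridge (support_fun W) b e" for b e
    unfolding ridge_def
  proof safe
    fix t :: real assume t: "0 < t"
    have "s * t * e \<le> support_fun W (s *\<^sub>R x + (s * t) *\<^sub>R b) - 2 * support_fun W (s *\<^sub>R x)
        + support_fun W (s *\<^sub>R x - (s * t) *\<^sub>R b)"
      using that s t by (simp add: ridge_def)
    also have "\<dots> = s * (support_fun W (x + t *\<^sub>R b) - 2 * support_fun W x + support_fun W (x - t *\<^sub>R b))"
      using support_fun_scale[OF W s, of "x + t *\<^sub>R b"] support_fun_scale[OF W s, of x]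
        support_fun_scale[OF W s, of "x - t *\<^sub>R b"] by (simp add: algebra_simps)
    finally show "t * e \<le> support_fun W (x + t *\<^sub>R b) - 2 * support_fun W x + support_fun W (x - t *\<^sub>R b)"
      using s by simp
  qed
  with x show ?thesis by (auto simp: crease_def)
qed


section \<open>Spherical Lebesgue measure\<close>

lemma normalize_measurable:
  "(\<lambda>x::'a::euclidean_space. x /\<^sub>R norm x) \<in>
     scale_measure c (restrict_space lborel (ball 0 1 - {0})) \<rightarrow>\<^sub>M sphere_borel"
proof -
  have "(\<lambda>x::'a. x /\<^sub>R norm x) \<in> restrict_space borel (ball 0 1 - {0}) \<rightarrow>\<^sub>M sphere_borel"
    by (intro measurable_restrict_space2 measurable_restrict_space1) (auto simp: space_restrict_space)
  then show ?thesis
    by (subst measurable_cong_sets[where M' = "restrict_space borel (ball 0 1 - {0})", OF _ refl])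
      (simp_all add: sets_restrict_space)
qed

lemma emeasure_sphere_lebesgue:
  fixes A :: "'a::euclidean_space set"
  assumes "A \<in> sets sphere_borel"
  shows "emeasure sphere_lebesgue A = of_nat DIM('a) * emeasure lborel {x \<in> ball 0 1 - {0}. x /\<^sub>R norm x \<in> A}"
proof -
  have "(\<lambda>x::'a. x /\<^sub>R norm x) -` A \<inter> (ball 0 1 - {0}) = {x \<in> ball 0 1 - {0}. x /\<^sub>R norm x \<in> A}"
    by auto
  moreover have "emeasure (restrict_space lborel (ball 0 1 - {0})) {x \<in> ball 0 1 - {0}. x /\<^sub>R norm x \<in> A}
      = emeasure lborel {x \<in> ball 0 1 - {0}. x /\<^sub>R norm x \<in> A}"
    by (rule emeasure_restrict_space) auto
  ultimately show ?thesis
    using assms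
    by (simp add: sphere_lebesgue_def emeasure_completion emeasure_distr[OF normalize_measurable]
        space_restrict_space space_scale_measure)
qed

lemma space_sphere_lebesgue [simp]: "space sphere_lebesgue = sphere (0::'a::euclidean_space) 1"
  by (simp add: sphere_lebesgue_def space_restrict_space)

lemma sphere_borel_sets_lebesgue:
  "A \<in> sets sphere_borel \<Longrightarrow> A \<in> sets (sphere_lebesgue :: 'a::euclidean_space measure)"
  by (auto simp: sphere_lebesgue_def)

lemma measurable_sphere_lebesgue:
  "f \<in> sphere_borel \<rightarrow>\<^sub>M N \<Longrightarrow> f \<in> (sphere_lebesgue :: 'a::euclidean_space measure) \<rightarrow>\<^sub>M N"
  unfolding sphere_lebesgue_def by (intro measurable_completion) simp

lemma continuous_measurable_sphere_lebesgue:
  fixes f :: "'a::euclidean_space \<Rightarrow> 'b::topological_space"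
  assumes "continuous_on (sphere 0 1) f"
  shows "f \<in> borel_measurable sphere_lebesgue"
  using assms by (intro measurable_sphere_lebesgue borel_measurable_continuous_on_restrict)

lemma finite_sphere_lebesgue: "finite_measure (sphere_lebesgue :: 'a::euclidean_space measure)"
proof
  have "emeasure (sphere_lebesgue :: 'a measure) (sphere 0 1) = of_nat DIM('a) * emeasure lborel {x::'a \<in> ball 0 1 - {0}. x /\<^sub>R norm x \<in> sphere 0 1}"
    by (rule emeasure_sphere_lebesgue) (auto simp: sets_restrict_space)
  also have "\<dots> < \<infinity>"
  proof -
    have "emeasure lborel {x::'a \<in> ball 0 1 - {0}. x /\<^sub>R norm x \<in> sphere 0 1} < \<infinity>"
      by (intro emeasure_bounded_finite bounded_subset[OF bounded_ball[of 0 1]]) auto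
    then show ?thesis by (simp add: ennreal_mult_less_top of_nat_less_top)
  qed
  finally show "emeasure (sphere_lebesgue :: 'a measure) (space sphere_lebesgue) \<noteq> \<infinity>" by simp
qed

lemma sphere_lebesgue_null_cone:
  fixes N :: "'a::euclidean_space set"
  assumes N: "N \<in> null_sets lborel" and cone: "\<And>s x. 0 < s \<Longrightarrow> s *\<^sub>R x \<in> N \<Longrightarrow> x \<in> N"
  shows "sphere 0 1 \<inter> N \<in> null_sets sphere_lebesgue"
proof -
  have S: "sphere 0 1 \<inter> N \<in> sets sphere_borel"
    using N by (auto simp: sets_restrict_space null_sets_def)
  have "emeasure lborel {x::'a \<in> ball 0 1 - {0}. x /\<^sub>R norm x \<in> sphere 0 1 \<inter> N} \<le> emeasure lborel N"
  proof (rule emeasure_mono)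
    show "{x::'a \<in> ball 0 1 - {0}. x /\<^sub>R norm x \<in> sphere 0 1 \<inter> N} \<subseteq> N"
    proof
      fix x :: 'a assume "x \<in> {x::'a \<in> ball 0 1 - {0}. x /\<^sub>R norm x \<in> sphere 0 1 \<inter> N}"
      then show "x \<in> N" using cone[of "inverse (norm x)" x] by auto
    qed
  qed (use N in auto)
  also have "\<dots> = 0" using N by auto
  finally have "emeasure sphere_lebesgue (sphere 0 1 \<inter> N) = 0"
    using emeasure_sphere_lebesgue[OF S] by simp
  with sphere_borel_sets_lebesgue[OF S] show ?thesis by (auto simp: null_sets_def)
qed

text \<open>Scaled into the unit ball, the ball around \<open>c\<close> lies in the cone over its directions, so the
  measure of these directions is at least \<open>n\<close> times the volume of the scaled ball. That volume does
  not depend on \<open>c\<close>.\<close>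

lemma sphere_measure_directions_of_ball:
  fixes R \<delta> :: real
  assumes R: "0 < R" and \<delta>: "0 < \<delta>"
  obtains m where "0 < m"
    "\<And>(E::'a::euclidean_space set) c. E \<in> sets sphere_borel \<Longrightarrow> norm c \<le> R \<Longrightarrow>
       (\<And>y. y \<in> ball c \<delta> \<Longrightarrow> y \<noteq> 0 \<Longrightarrow> y /\<^sub>R norm y \<in> E) \<Longrightarrow> m \<le> measure sphere_lebesgue E"
proof -
  define s where "s = R + \<delta>"
  have s: "0 < s" using assms by (simp add: s_def)
  define m where "m = real DIM('a) * measure lborel (ball (0::'a) (\<delta> / s))"
  have "0 < m" using \<delta> s by (simp add: m_def content_ball_pos)
  moreover have "m \<le> measure sphere_lebesgue E"
    if E: "E \<in> sets sphere_borel" and c: "norm c \<le> R"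
      and dir: "\<And>y. y \<in> ball c \<delta> \<Longrightarrow> y \<noteq> 0 \<Longrightarrow> y /\<^sub>R norm y \<in> E" for E :: "'a set" and c
  proof -
    interpret finite_measure "sphere_lebesgue :: 'a measure" by (rule finite_sphere_lebesgue)
    let ?B = "{x \<in> ball 0 1 - {0}. x /\<^sub>R norm x \<in> E}"
    have sub: "ball (c /\<^sub>R s) (\<delta> / s) - {0} \<subseteq> ?B"
    proof
      fix x assume x: "x \<in> ball (c /\<^sub>R s) (\<delta> / s) - {0}"
      have "s *\<^sub>R x - c = s *\<^sub>R (x - c /\<^sub>R s)" using s by (simp add: algebra_simps)
      then have "norm (s *\<^sub>R x - c) = s * norm (x - c /\<^sub>R s)" using s by simp
      also have "\<dots> < s * (\<delta> / s)"
        using x s by (intro mult_strict_left_mono) (auto simp: dist_norm norm_minus_commute)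
      finally have lt: "norm (s *\<^sub>R x - c) < \<delta>" using s by simp
      have "(s *\<^sub>R x) /\<^sub>R norm (s *\<^sub>R x) \<in> E"
        by (rule dir) (use lt x s in \<open>auto simp: dist_norm norm_minus_commute\<close>)
      then have "x /\<^sub>R norm x \<in> E" using s by (simp add: field_simps)
      moreover have "norm (s *\<^sub>R x) < s" using lt c norm_triangle_ineq2[of "s *\<^sub>R x" c] by (simp add: s_def)
      then have "norm x < 1" using s by simp
      ultimately show "x \<in> ?B" using x by auto
    qed
    have Bm: "?B \<in> sets lborel"
    proof -
      have "(\<lambda>x. x /\<^sub>R norm x) -` E \<inter> (ball 0 1 - {0}) \<in> sets (restrict_space lborel (ball 0 1 - {0}))"
        using measurable_sets[OF normalize_measurable[where c = 1] E]
        by (simp add: space_restrict_space space_scale_measure)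
      then have "(\<lambda>x. x /\<^sub>R norm x) -` E \<inter> (ball 0 1 - {0}) \<in> sets lborel"
        by (subst (asm) sets_restrict_space_iff) auto
      also have "(\<lambda>x. x /\<^sub>R norm x) -` E \<inter> (ball 0 1 - {0}) = ?B" by auto
      finally show ?thesis .
    qed
    have "emeasure lborel (ball (0::'a) (\<delta> / s)) = emeasure lborel (ball (c /\<^sub>R s) (\<delta> / s))"
      using \<delta> s by (simp add: emeasure_ball)
    also have "\<dots> = emeasure lborel (ball (c /\<^sub>R s) (\<delta> / s) - {0})"
      by (rule emeasure_Diff_null_set[symmetric]) auto
    also have "\<dots> \<le> emeasure lborel ?B" using sub Bm by (rule emeasure_mono)
    finally have "of_nat DIM('a) * emeasure lborel (ball (0::'a) (\<delta> / s)) \<le> emeasure sphere_lebesgue E"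
      unfolding emeasure_sphere_lebesgue[OF E] by (rule mult_left_mono) simp
    moreover have "emeasure lborel (ball (0::'a) (\<delta> / s)) = ennreal (measure lborel (ball (0::'a) (\<delta> / s)))"
      using emeasure_lborel_ball_finite[of "0::'a" "\<delta> / s"] by (intro emeasure_eq_ennreal_measure) auto
    ultimately show ?thesis
      by (simp add: m_def emeasure_eq_measure ennreal_of_nat_eq_real_of_nat flip: ennreal_mult')
  qed
  ultimately show thesis using that by blast
qed


section \<open>The radial Gauss map and the curvature measures\<close>

definition gauss_map :: "'a::euclidean_space set \<Rightarrow> 'a \<Rightarrow> 'a" where
  "gauss_map K u = (SOME v. norm v = 1 \<and> radial_fun K u * (u \<bullet> v) = support_fun K v)"

lemma gauss_map:
  fixes K :: "'a::euclidean_space set"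
  assumes "K \<in> convex_bodies_o" "norm u = 1"
  shows norm_gauss_map: "norm (gauss_map K u) = 1"
    and gauss_map_support: "radial_fun K u * (u \<bullet> gauss_map K u) = support_fun K (gauss_map K u)"
proof -
  have "\<exists>v. norm v = 1 \<and> radial_fun K u * (u \<bullet> v) = support_fun K v"
    using radial_point_has_normal[OF assms] by metis
  from someI_ex[OF this] show "norm (gauss_map K u) = 1"
    "radial_fun K u * (u \<bullet> gauss_map K u) = support_fun K (gauss_map K u)"
    by (auto simp: gauss_map_def)
qed

text \<open>The elements of \<^const>\<open>scaled_normals\<close> that belong to two normals at \<open>\<rho>\<^sub>K(u) u\<close> both maximize the
  inner product with \<open>u\<close>, hence coincide; a unit normal is recovered from its scaled version by
  normalization.\<close>

lemma normal_unique_off_crease: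
  fixes K :: "'a::euclidean_space set"
  assumes K: "K \<in> convex_bodies_o" and u: "norm u = 1" "u \<notin> crease (scaled_normals K)"
    and v: "norm v = 1" "radial_fun K u * (u \<bullet> v) = support_fun K v"
  shows "gauss_map K u = v"
proof -
  note g = gauss_map[OF K u(1)]
  let ?a = "gauss_map K u"
  have "?a /\<^sub>R support_fun K ?a = v /\<^sub>R support_fun K v"
    by (rule unique_maximizer_off_crease[OF scaled_normals_bounded[OF K] u(2)])
      (use normal_maximizes_over_scaled_normals(1)[OF K u(1) g]
           normal_maximizes_over_scaled_normals(1)[OF K u(1) v] v g
       in \<open>auto simp: scaled_normals_def\<close>)
  then have eq: "sgn (?a /\<^sub>R support_fun K ?a) = sgn (v /\<^sub>R support_fun K v)" by simp
  have "sgn (w /\<^sub>R support_fun K w) = w" if "norm w = 1" for w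
    using support_fun_pos[OF K that] that by (simp add: sgn_div_norm)
  with eq v(1) g(1) show ?thesis by simp
qed

lemma crease_null_sphere:
  fixes K :: "'a::euclidean_space set"
  assumes K: "K \<in> convex_bodies_o"
  shows "sphere 0 1 \<inter> crease (scaled_normals K) \<in> null_sets sphere_lebesgue"
proof (rule sphere_lebesgue_null_cone)
  note W = scaled_normals_bounded[OF K] scaled_normals_nonempty
  show "crease (scaled_normals K) \<in> null_sets lborel" by (rule crease_null[OF W])
  show "\<And>s x. 0 < s \<Longrightarrow> s *\<^sub>R x \<in> crease (scaled_normals K) \<Longrightarrow> x \<in> crease (scaled_normals K)"
    by (rule crease_scale[OF W])
qed

lemma gauss_map_preimage_reverse_image:
  fixes K :: "'a::euclidean_space set"
  assumes K: "K \<in> convex_bodies_o" and u: "norm u = 1"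
  shows "gauss_map K u \<in> \<eta> \<Longrightarrow> u \<in> reverse_radial_gauss_image K \<eta>"
    and "u \<notin> crease (scaled_normals K) \<Longrightarrow> \<eta> \<subseteq> sphere 0 1 \<Longrightarrow>
           u \<in> reverse_radial_gauss_image K \<eta> \<Longrightarrow> gauss_map K u \<in> \<eta>"
proof -
  show "u \<in> reverse_radial_gauss_image K \<eta>" if "gauss_map K u \<in> \<eta>"
    unfolding reverse_radial_gauss_image_def
    using that gauss_map_support[OF K u] u by (auto intro!: bexI[of _ "gauss_map K u"])
  show "gauss_map K u \<in> \<eta>"
    if h: "u \<notin> crease (scaled_normals K)" "\<eta> \<subseteq> sphere 0 1" "u \<in> reverse_radial_gauss_image K \<eta>"
  proof -
    obtain v where v: "v \<in> \<eta>" "radial_fun K u * (u \<bullet> v) = support_fun K v"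
      using h(3) by (auto simp: reverse_radial_gauss_image_def)
    then have "norm v = 1" using h(2) by auto
    then show ?thesis using normal_unique_off_crease[OF K u h(1) _ v(2)] v(1) by simp
  qed
qed

text \<open>This set is the projection of a compact subset of the product of the sphere with \<open>C\<close>.\<close>

lemma closed_reverse_radial_gauss_image:
  fixes K :: "'a::euclidean_space set"
  assumes K: "K \<in> convex_bodies_o" and C: "closed C" "C \<subseteq> sphere 0 1"
  shows "closed (reverse_radial_gauss_image K C)"
proof -
  let ?T = "sphere 0 1 \<times> C"
  let ?f = "\<lambda>z. (radial_fun K (fst z) *\<^sub>R fst z) \<bullet> snd z - support_fun K (snd z)"
  have cC: "compact C" using C by (meson compact_eq_bounded_closed bounded_subset bounded_sphere)
  have "continuous_on ?T ?f"
    using radial_fun_continuous[OF K] support_fun_continuous[OF convex_bodies_oD(3,5)[OF K]]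
    by (intro continuous_intros continuous_on_compose2[of "sphere 0 1" "radial_fun K" _ fst]
        continuous_on_compose2[of UNIV "support_fun K" _ snd]) auto
  then have "closed (?T \<inter> ?f -` {0})"
    using C by (intro continuous_closed_preimage closed_Times closed_sphere) auto
  then have "compact (?T \<inter> (?T \<inter> ?f -` {0}))"
    using cC by (intro compact_Int_closed compact_Times compact_sphere)
  then have "compact (fst ` (?T \<inter> (?T \<inter> ?f -` {0})))"
    by (intro compact_continuous_image continuous_intros)
  also have "fst ` (?T \<inter> (?T \<inter> ?f -` {0})) = reverse_radial_gauss_image K C"
    by (force simp: reverse_radial_gauss_image_def image_iff)
  finally show ?thesis by (rule compact_imp_closed)
qed

text \<open>An arbitrary choice of normals is measurable: the preimage of a closed set differs from the closed
  set of \<open>closed_reverse_radial_gauss_image\<close> by a part of a null set, and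
  \<^const>\<open>sphere_lebesgue\<close> is complete.\<close>

lemma gauss_map_measurable:
  fixes K :: "'a::euclidean_space set"
  assumes K: "K \<in> convex_bodies_o"
  shows "gauss_map K \<in> sphere_lebesgue \<rightarrow>\<^sub>M sphere_borel"
proof (rule measurable_restrict_space2)
  show "gauss_map K \<in> space sphere_lebesgue \<rightarrow> sphere 0 1" using norm_gauss_map[OF K] by auto
  have cl: "gauss_map K -` C \<inter> sphere 0 1 \<in> sets sphere_lebesgue" if C: "closed C" for C
  proof -
    let ?R = "reverse_radial_gauss_image K (C \<inter> sphere 0 1)"
    have cR: "closed ?R" by (rule closed_reverse_radial_gauss_image[OF K]) (use C in auto)
    have RS: "?R \<subseteq> sphere 0 1" by (auto simp: reverse_radial_gauss_image_def)
    have R: "?R \<in> sets sphere_lebesgue"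
      by (rule sphere_borel_sets_lebesgue) (use cR RS in \<open>auto simp: sets_restrict_space_iff\<close>)
    have "?R - gauss_map K -` C \<subseteq> sphere 0 1 \<inter> crease (scaled_normals K)"
      using gauss_map_preimage_reverse_image(2)[OF K, of _ "C \<inter> sphere 0 1"] RS by fastforce
    then have "?R - gauss_map K -` C \<in> null_sets sphere_lebesgue"
      using crease_null_sphere[OF K] unfolding sphere_lebesgue_def by (rule null_sets_completion_subset)
    then have "?R - (?R - gauss_map K -` C) \<in> sets sphere_lebesgue"
      by (intro sets.Diff R null_setsD2)
    also have "?R - (?R - gauss_map K -` C) = gauss_map K -` C \<inter> sphere 0 1"
      using gauss_map_preimage_reverse_image(1)[OF K, of _ "C \<inter> sphere 0 1"] norm_gauss_map[OF K] RS
      by auto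
    finally show ?thesis .
  qed
  show "gauss_map K \<in> borel_measurable sphere_lebesgue"
  proof (rule borel_measurableI)
    fix U :: "'a set" assume "open U"
    then have "gauss_map K -` (- U) \<inter> sphere 0 1 \<in> sets sphere_lebesgue" by (intro cl) auto
    then have "space sphere_lebesgue - (gauss_map K -` (- U) \<inter> sphere 0 1) \<in> sets sphere_lebesgue"
      by (rule sets.compl_sets)
    also have "space sphere_lebesgue - (gauss_map K -` (- U) \<inter> sphere 0 1)
        = gauss_map K -` U \<inter> space sphere_lebesgue" by auto
    finally show "gauss_map K -` U \<inter> space sphere_lebesgue \<in> sets sphere_lebesgue" .
  qed
qed

definition dual_density :: "real \<Rightarrow> 'a::euclidean_space set \<Rightarrow> 'a set \<Rightarrow> 'a \<Rightarrow> real" where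
  "dual_density q K Q u =
     radial_fun K u powr q * radial_fun Q u powr (real DIM('a) - q) / real DIM('a)"

lemma radial_fun_pos_convex:
  fixes K :: "'a::euclidean_space set"
  assumes "K \<in> convex_bodies_o" "norm u = 1"
  shows "0 < radial_fun K u"
  using assms radial_fun_pos convex_bodies_oD(1) by (auto simp: convex_bodies_o_def)

lemma radial_fun_pos_star:
  fixes Q :: "'a::euclidean_space set"
  assumes "Q \<in> star_bodies_o" "norm u = 1"
  shows "0 < radial_fun Q u"
  using assms by (intro radial_fun_pos) (auto simp: star_bodies_o_def star_body_def)

lemma radial_fun_powr_continuous:
  fixes K :: "'a::euclidean_space set"
  assumes "K \<in> convex_bodies_o"
  shows "continuous_on (sphere 0 1) (\<lambda>u. radial_fun K u powr a)"
  using radial_fun_pos_convex[OF assms] radial_fun_continuous[OF assms]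
  by (intro continuous_intros) force+

lemma star_powr_continuous:
  fixes Q :: "'a::euclidean_space set"
  assumes "Q \<in> star_bodies_o"
  shows "continuous_on (sphere 0 1) (\<lambda>u. radial_fun Q u powr a)"
  using radial_fun_pos_star[OF assms] assms
  by (intro continuous_intros) (force simp: star_bodies_o_def star_body_def)+

lemma dual_density_continuous:
  assumes "K \<in> convex_bodies_o" "Q \<in> star_bodies_o"
  shows "continuous_on (sphere 0 1) (dual_density q K Q)"
  unfolding dual_density_def[abs_def]
  by (intro continuous_intros radial_fun_powr_continuous star_powr_continuous assms) auto

lemma dual_density_nonneg: "0 \<le> dual_density q K Q u"
  by (simp add: dual_density_def)

text \<open>Off the crease, membership of \<open>u\<close> in the reverse radial Gauss image of \<open>\<eta>\<close> is the same as
  \<open>\<alpha>\<^sub>K(u) \<in> \<eta>\<close>, so the two domains of integration differ by a null set.\<close>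

lemma dual_curvature_eq_distr:
  fixes K Q :: "'a::euclidean_space set"
  assumes K: "K \<in> convex_bodies_o" and Q: "Q \<in> star_bodies_o" and \<eta>: "\<eta> \<in> sets sphere_borel"
  shows "dual_curvature q K Q \<eta> =
    emeasure (distr (density sphere_lebesgue (dual_density q K Q)) sphere_borel (gauss_map K)) \<eta>"
proof -
  let ?P = "gauss_map K -` \<eta> \<inter> sphere 0 1"
  let ?F = "\<lambda>u. radial_fun K u powr q * radial_fun Q u powr (real DIM('a) - q)"
  have Fm[measurable]: "?F \<in> borel_measurable sphere_lebesgue"
    by (intro continuous_measurable_sphere_lebesgue continuous_intros
        radial_fun_powr_continuous star_powr_continuous K Q)
  have dm[measurable]: "dual_density q K Q \<in> borel_measurable sphere_lebesgue"
    by (intro continuous_measurable_sphere_lebesgue dual_density_continuous K Q)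
  have Pm[measurable]: "?P \<in> sets sphere_lebesgue"
    using measurable_sets[OF gauss_map_measurable[OF K] \<eta>] by simp
  have sub: "\<eta> \<subseteq> sphere 0 1" using sets.sets_into_space[OF \<eta>] by (simp add: space_restrict_space)
  have "AE u in sphere_lebesgue. u \<notin> sphere 0 1 \<inter> crease (scaled_normals K)"
    by (rule AE_not_in[OF crease_null_sphere[OF K]])
  then have "AE u in sphere_lebesgue. ennreal (?F u) * indicator (reverse_radial_gauss_image K \<eta>) u
      = ennreal (?F u) * indicator ?P u"
    using AE_space
  proof eventually_elim
    case (elim u)
    then show ?case
      using gauss_map_preimage_reverse_image[OF K, of u \<eta>] sub by (auto simp: indicator_def)
  qed
  then have "dual_curvature q K Q \<eta> =
      ennreal (1 / real DIM('a)) * (\<integral>\<^sup>+ u. ennreal (?F u) * indicator ?P u \<partial>sphere_lebesgue)"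
    unfolding dual_curvature_def by (intro arg_cong[where f = "(*) _"] nn_integral_cong_AE)
  also have "\<dots> = (\<integral>\<^sup>+ u. ennreal (1 / real DIM('a)) * (ennreal (?F u) * indicator ?P u) \<partial>sphere_lebesgue)"
    by (rule nn_integral_cmult[symmetric]) measurable
  also have "\<dots> = (\<integral>\<^sup>+ u. ennreal (dual_density q K Q u) * indicator ?P u \<partial>sphere_lebesgue)"
  proof (rule nn_integral_cong)
    fix u
    show "ennreal (1 / real DIM('a)) * (ennreal (?F u) * indicator ?P u)
      = ennreal (dual_density q K Q u) * indicator ?P u"
    proof (cases "u \<in> ?P")
      case True
      have "dual_density q K Q u = 1 / real DIM('a) * ?F u" by (simp add: dual_density_def)
      then have "ennreal (dual_density q K Q u) = ennreal (1 / real DIM('a)) * ennreal (?F u)"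
        using ennreal_mult[of "1 / real DIM('a)" "?F u"] by simp
      with True show ?thesis by simp
    qed simp
  qed
  also have "\<dots> = emeasure (density sphere_lebesgue (dual_density q K Q)) ?P"
    by (rule emeasure_density[symmetric]) measurable
  also have "\<dots> = emeasure (distr (density sphere_lebesgue (dual_density q K Q)) sphere_borel (gauss_map K)) \<eta>"
    using gauss_map_measurable[OF K] \<eta> by (subst emeasure_distr) auto
  finally show ?thesis .
qed

text \<open>The set function agrees on Borel sets with an image measure, which makes its countable additivity
  evident.\<close>

lemma dual_curvature_measure_eq_distr:
  fixes K Q :: "'a::euclidean_space set"
  assumes K: "K \<in> convex_bodies_o" and Q: "Q \<in> star_bodies_o"
  shows "dual_curvature_measure q K Q =
    distr (density sphere_lebesgue (dual_density q K Q)) sphere_borel (gauss_map K)" (is "_ = ?D")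
proof -
  have sp: "space (sphere_borel :: 'a measure) = sphere 0 1" by (simp add: space_restrict_space)
  have "dual_curvature_measure q K Q = measure_of (sphere 0 1) (sets (sphere_borel :: 'a measure)) (emeasure ?D)"
    unfolding dual_curvature_measure_def
  proof (rule measure_of_eq)
    show "sets (sphere_borel :: 'a measure) \<subseteq> Pow (sphere 0 1)"
      using sets.space_closed[of "sphere_borel :: 'a measure"] by (simp add: sp)
    show "dual_curvature q K Q a = emeasure ?D a"
      if "a \<in> sigma_sets (sphere 0 1) (sets (sphere_borel :: 'a measure))" for a
      using that sets.sigma_sets_eq[of "sphere_borel :: 'a measure"]
      by (intro dual_curvature_eq_distr K Q) (simp add: sp)
  qed
  also have "\<dots> = ?D" using measure_of_of_measure[of ?D] by (simp add: sp)
  finally show ?thesis .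
qed

lemma sets_Lp_dual_curvature_measure:
  fixes K Q :: "'a::euclidean_space set"
  assumes "K \<in> convex_bodies_o" "Q \<in> star_bodies_o"
  shows "sets (Lp_dual_curvature_measure p q K Q) = sets sphere_borel"
    and "space (Lp_dual_curvature_measure p q K Q) = sphere 0 1"
  by (simp_all add: Lp_dual_curvature_measure_def dual_curvature_measure_eq_distr[OF assms]
      space_restrict_space)

lemma support_powr_continuous:
  fixes K :: "'a::euclidean_space set"
  assumes "K \<in> convex_bodies_o"
  shows "continuous_on (sphere 0 1) (\<lambda>v. support_fun K v powr a)"
  using support_fun_pos[OF assms] support_fun_continuous[OF convex_bodies_oD(3,5)[OF assms]]
  by (intro continuous_intros) force+

lemma integrable_sphere_lebesgue_bounded:
  fixes f :: "'a::euclidean_space \<Rightarrow> real"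
  assumes "f \<in> borel_measurable sphere_lebesgue" "\<And>u. norm u = 1 \<Longrightarrow> \<bar>f u\<bar> \<le> B"
  shows "integrable sphere_lebesgue f"
  using assms by (intro finite_measure.integrable_const_bound[OF finite_sphere_lebesgue, where B = B])
    auto

lemma continuous_sphere_bounded:
  fixes f :: "'a::euclidean_space \<Rightarrow> real"
  assumes "continuous_on (sphere 0 1) f"
  obtains B where "0 < B" "\<And>u. norm u = 1 \<Longrightarrow> \<bar>f u\<bar> \<le> B"
proof -
  have "bounded (f ` sphere 0 1)"
    using assms by (intro compact_imp_bounded compact_continuous_image compact_sphere)
  then obtain B where "0 < B" "\<And>x. x \<in> f ` sphere 0 1 \<Longrightarrow> norm x \<le> B"
    by (auto simp: bounded_pos)
  then show thesis by (intro that[of B]) auto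
qed

lemma continuous_sphere_integrable:
  fixes f :: "'a::euclidean_space \<Rightarrow> real"
  assumes "continuous_on (sphere 0 1) f"
  shows "integrable sphere_lebesgue f"
  using continuous_sphere_bounded[OF assms] continuous_measurable_sphere_lebesgue[OF assms]
  by (metis integrable_sphere_lebesgue_bounded)

lemma comp_gauss_map_measurable:
  fixes f :: "'a::euclidean_space \<Rightarrow> real"
  assumes "K \<in> convex_bodies_o" "continuous_on (sphere 0 1) f"
  shows "(\<lambda>u. f (gauss_map K u)) \<in> borel_measurable sphere_lebesgue"
  using borel_measurable_continuous_on_restrict[OF assms(2)]
  by (rule measurable_compose[OF gauss_map_measurable[OF assms(1)]])

lemma gauss_map_integrable:
  fixes f :: "'a::euclidean_space \<Rightarrow> real"
  assumes K: "K \<in> convex_bodies_o" and g: "continuous_on (sphere 0 1) g" and f: "continuous_on (sphere 0 1) f"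
  shows "integrable sphere_lebesgue (\<lambda>u. g u * f (gauss_map K u))"
proof -
  obtain B where B: "0 < B" "\<And>u. norm u = 1 \<Longrightarrow> \<bar>g u\<bar> \<le> B"
    using continuous_sphere_bounded[OF g] by blast
  obtain C where C: "0 < C" "\<And>u. norm u = 1 \<Longrightarrow> \<bar>f u\<bar> \<le> C"
    using continuous_sphere_bounded[OF f] by blast
  show ?thesis
  proof (rule integrable_sphere_lebesgue_bounded)
    show "(\<lambda>u. g u * f (gauss_map K u)) \<in> borel_measurable sphere_lebesgue"
      by (intro borel_measurable_times comp_gauss_map_measurable continuous_measurable_sphere_lebesgue K f g)
    show "\<bar>g u * f (gauss_map K u)\<bar> \<le> B * C" if "norm u = 1" for u
      unfolding abs_mult using B C norm_gauss_map[OF K that] that by (intro mult_mono) auto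
  qed
qed

lemma integral_Lp_dual_curvature_measure:
  fixes K Q :: "'a::euclidean_space set"
  assumes K: "K \<in> convex_bodies_o" and Q: "Q \<in> star_bodies_o" and f: "continuous_on (sphere 0 1) f"
  shows "integral\<^sup>L (Lp_dual_curvature_measure p q K Q) f =
    (\<integral>u. dual_density q K Q u * (support_fun K (gauss_map K u) powr (- p) * f (gauss_map K u)) \<partial>sphere_lebesgue)"
proof -
  have fm[measurable]: "f \<in> borel_measurable sphere_borel"
    by (rule borel_measurable_continuous_on_restrict[OF f])
  have hm[measurable]: "(\<lambda>v. support_fun K v powr (- p)) \<in> borel_measurable sphere_borel"
    by (rule borel_measurable_continuous_on_restrict[OF support_powr_continuous[OF K]])
  have gm[measurable]: "gauss_map K \<in> sphere_lebesgue \<rightarrow>\<^sub>M sphere_borel" by (rule gauss_map_measurable[OF K])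
  have dm[measurable]: "dual_density q K Q \<in> borel_measurable sphere_lebesgue"
    by (intro continuous_measurable_sphere_lebesgue dual_density_continuous K Q)
  have "integral\<^sup>L (Lp_dual_curvature_measure p q K Q) f =
     (\<integral>v. support_fun K v powr (- p) *\<^sub>R f v
        \<partial>distr (density sphere_lebesgue (dual_density q K Q)) sphere_borel (gauss_map K))"
    unfolding Lp_dual_curvature_measure_def dual_curvature_measure_eq_distr[OF K Q]
    by (rule integral_density) auto
  also have "\<dots> = (\<integral>u. support_fun K (gauss_map K u) powr (- p) *\<^sub>R f (gauss_map K u)
      \<partial>density sphere_lebesgue (dual_density q K Q))"
    by (rule integral_distr) (simp_all, measurable)
  also have "\<dots> = (\<integral>u. dual_density q K Q u *\<^sub>R (support_fun K (gauss_map K u) powr (- p) *\<^sub>R f (gauss_map K u))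
      \<partial>sphere_lebesgue)"
    by (rule integral_density) (auto simp: dual_density_nonneg)
  finally show ?thesis by simp
qed

lemma finite_Lp_dual_curvature_measure:
  fixes K Q :: "'a::euclidean_space set"
  assumes K: "K \<in> convex_bodies_o" and Q: "Q \<in> star_bodies_o"
  shows "finite_measure (Lp_dual_curvature_measure p q K Q)"
proof
  let ?h = "\<lambda>v. support_fun K v powr (- p)"
  have hm[measurable]: "?h \<in> borel_measurable sphere_borel"
    by (rule borel_measurable_continuous_on_restrict[OF support_powr_continuous[OF K]])
  have gm[measurable]: "gauss_map K \<in> sphere_lebesgue \<rightarrow>\<^sub>M sphere_borel" by (rule gauss_map_measurable[OF K])
  have dm[measurable]: "dual_density q K Q \<in> borel_measurable sphere_lebesgue"
    by (intro continuous_measurable_sphere_lebesgue dual_density_continuous K Q)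
  let ?D = "distr (density sphere_lebesgue (dual_density q K Q)) sphere_borel (gauss_map K)"
  have spD: "space ?D = sphere 0 1" by (simp add: space_restrict_space)
  have "emeasure (Lp_dual_curvature_measure p q K Q) (space (Lp_dual_curvature_measure p q K Q))
      = (\<integral>\<^sup>+ v. ennreal (?h v) * indicator (space ?D) v \<partial>?D)"
    unfolding Lp_dual_curvature_measure_def dual_curvature_measure_eq_distr[OF K Q] space_density
    by (intro emeasure_density sets.top) measurable
  also have "\<dots> = (\<integral>\<^sup>+ v. ennreal (?h v) \<partial>?D)"
    by (intro nn_integral_cong) (simp add: indicator_def)
  also have "\<dots> = (\<integral>\<^sup>+ u. ennreal (?h (gauss_map K u)) \<partial>density sphere_lebesgue (dual_density q K Q))"
    by (rule nn_integral_distr) (simp_all, measurable)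
  also have "\<dots> = (\<integral>\<^sup>+ u. ennreal (dual_density q K Q u) * ennreal (?h (gauss_map K u)) \<partial>sphere_lebesgue)"
    by (rule nn_integral_density) measurable
  also have "\<dots> = (\<integral>\<^sup>+ u. ennreal (dual_density q K Q u * ?h (gauss_map K u)) \<partial>sphere_lebesgue)"
    by (intro nn_integral_cong ennreal_mult[symmetric]) (auto simp: dual_density_nonneg)
  also have "\<dots> = ennreal (\<integral>u. dual_density q K Q u * ?h (gauss_map K u) \<partial>sphere_lebesgue)"
    by (intro nn_integral_eq_integral gauss_map_integrable dual_density_continuous support_powr_continuous K Q)
      (auto simp: dual_density_nonneg)
  finally show "emeasure (Lp_dual_curvature_measure p q K Q) (space (Lp_dual_curvature_measure p q K Q)) \<noteq> \<infinity>"
    by simp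
qed


section \<open>Weak convergence on equicontinuous families\<close>

lemma integrable_sphere_continuous:
  fixes f :: "'a::euclidean_space \<Rightarrow> real"
  assumes M: "sets M = sets sphere_borel" "finite_measure M" and f: "continuous_on (sphere 0 1) f"
  shows "integrable M f"
proof -
  obtain B where B: "\<And>u. norm u = 1 \<Longrightarrow> \<bar>f u\<bar> \<le> B" using continuous_sphere_bounded[OF f] by blast
  have sp: "space M = sphere 0 1" using sets_eq_imp_space_eq[OF M(1)] by (simp add: space_restrict_space)
  have "f \<in> borel_measurable M"
    using borel_measurable_continuous_on_restrict[OF f] by (subst measurable_cong_sets[OF M(1) refl])
  then show ?thesis
    by (rule finite_measure.integrable_const_bound[OF M(2), where B = B, rotated])
      (auto intro!: AE_I2 B simp: sp)
qed

lemma integral_uniform_close: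
  fixes f g :: "'a::euclidean_space \<Rightarrow> real"
  assumes M: "sets M = sets sphere_borel" "finite_measure M"
    and f: "continuous_on (sphere 0 1) f" and g: "continuous_on (sphere 0 1) g"
    and le: "\<And>u. norm u = 1 \<Longrightarrow> \<bar>f u - g u\<bar> \<le> e"
  shows "\<bar>integral\<^sup>L M f - integral\<^sup>L M g\<bar> \<le> e * measure M (sphere 0 1)"
proof -
  have sp: "space M = sphere 0 1" using sets_eq_imp_space_eq[OF M(1)] by (simp add: space_restrict_space)
  note int = integrable_sphere_continuous[OF M]
  have "\<bar>integral\<^sup>L M f - integral\<^sup>L M g\<bar> = \<bar>\<integral>u. f u - g u \<partial>M\<bar>"
    using int[OF f] int[OF g] by simp
  also have "\<dots> \<le> (\<integral>u. \<bar>f u - g u\<bar> \<partial>M)" by (rule integral_abs_bound)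
  also have "\<dots> \<le> (\<integral>u. e \<partial>M)"
    by (intro integral_mono int continuous_intros f g) (auto simp: sp intro!: le)
  also have "\<dots> = e * measure M (sphere 0 1)" by (simp add: sp)
  finally show ?thesis .
qed

text \<open>If the differences did not tend to zero, the Arzela-Ascoli theorem would give a uniformly convergent
  subsequence \<open>f\<^sub>i \<rightarrow> g\<close> along which they stay away from zero. As the total masses are bounded,
  \<open>f\<^sub>i\<close> may be replaced by the fixed function \<open>g\<close>, for which weak convergence applies.\<close>

lemma weak_convergence_equicontinuous:
  fixes M :: "nat \<Rightarrow> 'a::euclidean_space measure" and f :: "nat \<Rightarrow> 'a \<Rightarrow> real"
    and \<phi> :: "real \<Rightarrow> real"
  assumes wc: "sphere_weakly_converges M N"
    and M: "\<And>i. sets (M i) = sets sphere_borel" "\<And>i. finite_measure (M i)"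
    and N: "sets N = sets sphere_borel" "finite_measure N"
    and lip: "\<And>i u v. norm u = 1 \<Longrightarrow> norm v = 1 \<Longrightarrow> \<bar>f i u - f i v\<bar> \<le> L * norm (u - v)"
    and ran: "\<And>i u. norm u = 1 \<Longrightarrow> f i u \<in> {a..b}"
    and \<phi>: "continuous_on {a..b} \<phi>"
  shows "(\<lambda>i. (\<integral>u. \<phi> (f i u) \<partial>M i) - (\<integral>u. \<phi> (f i u) \<partial>N)) \<longlonglongrightarrow> 0"
proof (rule ccontr)
  define X where "X = (\<lambda>i. (\<integral>u. \<phi> (f i u) \<partial>M i) - (\<integral>u. \<phi> (f i u) \<partial>N))"
  assume "\<not> ?thesis"
  then obtain \<epsilon> where \<epsilon>: "0 < \<epsilon>" "\<And>n. \<exists>i\<ge>n. \<epsilon> \<le> \<bar>X i\<bar>"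
    unfolding X_def[symmetric] LIMSEQ_iff by (auto simp: not_less)
  then have "infinite {i. \<epsilon> \<le> \<bar>X i\<bar>}" by (auto simp: infinite_nat_iff_unbounded_le)
  then obtain r :: "nat \<Rightarrow> nat" where r: "strict_mono r" "\<And>n. \<epsilon> \<le> \<bar>X (r n)\<bar>"
    using infinite_enumerate by blast
  have L: "\<bar>f i u - f i v\<bar> \<le> (\<bar>L\<bar> + 1) * norm (u - v)" if "norm u = 1" "norm v = 1" for i u v
  proof -
    have "L * norm (u - v) \<le> (\<bar>L\<bar> + 1) * norm (u - v)" by (intro mult_right_mono) auto
    with lip[OF that, of i] show ?thesis by linarith
  qed
  have fc: "continuous_on (sphere 0 1) (f i)" for i
  proof -
    have "(\<bar>L\<bar> + 1)-lipschitz_on (sphere 0 1) (f i)"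
      using L by (intro lipschitz_onI) (auto simp: dist_norm)
    then show ?thesis by (rule lipschitz_on_continuous_on)
  qed
  have eq: "\<exists>d>0. \<forall>n y. y \<in> sphere 0 1 \<and> norm (x - y) < d \<longrightarrow> norm (f (r n) x - f (r n) y) < e"
    if x: "x \<in> sphere 0 1" and e: "0 < e" for x :: 'a and e :: real
  proof (intro exI[of _ "e / (\<bar>L\<bar> + 1)"] conjI allI impI)
    show "0 < e / (\<bar>L\<bar> + 1)" using e by (intro divide_pos_pos) auto
    fix n y assume y: "y \<in> sphere 0 1 \<and> norm (x - y) < e / (\<bar>L\<bar> + 1)"
    have "\<bar>f (r n) x - f (r n) y\<bar> \<le> (\<bar>L\<bar> + 1) * norm (x - y)" using L x y by auto
    also have "\<dots> < e" using y by (simp add: field_simps)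
    finally show "norm (f (r n) x - f (r n) y) < e" by simp
  qed
  have bd: "norm (f (r n) x) \<le> \<bar>a\<bar> + \<bar>b\<bar>" if "x \<in> sphere 0 1" for n x
    using ran[of x "r n"] that by auto
  obtain g k where g: "continuous_on (sphere 0 1) g" "strict_mono (k :: nat \<Rightarrow> nat)"
    "\<And>e. 0 < e \<Longrightarrow> \<exists>n0. \<forall>n x. n \<ge> n0 \<and> x \<in> sphere 0 1 \<longrightarrow> norm (f (r (k n)) x - g x) < e"
    using Arzela_Ascoli[of "sphere 0 1" "\<lambda>n. f (r n)", OF compact_sphere bd eq] by blast
  define s where "s = r \<circ> k"
  have s: "strict_mono s" unfolding s_def using r(1) g(2) by (rule strict_mono_o)
  have sX: "\<epsilon> \<le> \<bar>X (s n)\<bar>" for n using r(2) by (simp add: s_def)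
  have unif: "\<exists>n0. \<forall>n\<ge>n0. \<forall>x. norm x = 1 \<longrightarrow> \<bar>f (s n) x - g x\<bar> < e" if "0 < e" for e
    using g(3)[OF that] by (auto simp: s_def)
  have gran: "g x \<in> {a..b}" if "norm x = 1" for x
  proof -
    have "(\<lambda>n. f (s n) x) \<longlonglongrightarrow> g x"
      unfolding LIMSEQ_iff using unif that by (metis real_norm_def)
    then show ?thesis by (rule closed_sequentially[OF closed_atLeastAtMost ran[OF that]])
  qed
  have comp: "continuous_on (sphere 0 1) (\<lambda>u. \<phi> (F u))"
    if "continuous_on (sphere 0 1) F" "\<And>u. norm u = 1 \<Longrightarrow> F u \<in> {a..b}" for F :: "'a \<Rightarrow> real"
    by (rule continuous_on_compose2[OF \<phi> that(1)]) (use that(2) in auto)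
  define m where "m = measure N (sphere 0 1) + 1"
  have m0: "0 < m" by (simp add: m_def add_nonneg_pos)
  have spM: "space (M i) = sphere 0 1" for i
    using sets_eq_imp_space_eq[OF M(1)] by (simp add: space_restrict_space)
  have spN: "space N = sphere 0 1"
    using sets_eq_imp_space_eq[OF N(1)] by (simp add: space_restrict_space)
  have "(\<lambda>i. integral\<^sup>L (M i) (\<lambda>u. 1::real)) \<longlonglongrightarrow> integral\<^sup>L N (\<lambda>u. 1)"
    using wc continuous_on_const unfolding sphere_weakly_converges_def by blast
  then have "(\<lambda>i. measure (M i) (sphere 0 1)) \<longlonglongrightarrow> measure N (sphere 0 1)"
    by (simp add: spM spN)
  then have "(\<lambda>n. measure (M (s n)) (sphere 0 1)) \<longlonglongrightarrow> measure N (sphere 0 1)"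
    using LIMSEQ_subseq_LIMSEQ[OF _ s] by (fastforce simp: comp_def)
  then have mass: "\<forall>\<^sub>F n in sequentially. measure (M (s n)) (sphere 0 1) < m"
    by (rule order_tendstoD) (simp add: m_def)
  have "(\<lambda>i. integral\<^sup>L (M i) (\<lambda>u. \<phi> (g u))) \<longlonglongrightarrow> integral\<^sup>L N (\<lambda>u. \<phi> (g u))"
    using wc comp[OF g(1) gran] unfolding sphere_weakly_converges_def by blast
  then have "(\<lambda>n. integral\<^sup>L (M (s n)) (\<lambda>u. \<phi> (g u))) \<longlonglongrightarrow> integral\<^sup>L N (\<lambda>u. \<phi> (g u))"
    using LIMSEQ_subseq_LIMSEQ[OF _ s] by (fastforce simp: comp_def)
  then have lim: "\<forall>\<^sub>F n in sequentially.
      \<bar>integral\<^sup>L (M (s n)) (\<lambda>u. \<phi> (g u)) - integral\<^sup>L N (\<lambda>u. \<phi> (g u))\<bar> < \<epsilon> / 4"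
    using \<epsilon>(1) tendstoD[of _ _ _ "\<epsilon> / 4"] by (fastforce simp: dist_real_def)
  define e where "e = \<epsilon> / (4 * m)"
  have e: "0 < e" using \<epsilon>(1) m0 by (simp add: e_def)
  have "uniformly_continuous_on {a..b} \<phi>" by (rule compact_uniformly_continuous[OF \<phi>]) simp
  then obtain d where d: "0 < d" "\<And>x y. x \<in> {a..b} \<Longrightarrow> y \<in> {a..b} \<Longrightarrow> \<bar>x - y\<bar> < d \<Longrightarrow> \<bar>\<phi> x - \<phi> y\<bar> < e"
    unfolding uniformly_continuous_on_def dist_real_def using e by metis
  have "\<forall>\<^sub>F n in sequentially. \<forall>x. norm x = 1 \<longrightarrow> \<bar>f (s n) x - g x\<bar> < d"
    using unif[OF d(1)] by (simp add: eventually_sequentially)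
  with mass lim have "\<forall>\<^sub>F n in sequentially. False"
  proof eventually_elim
    case (elim n)
    let ?F = "\<lambda>u. \<phi> (f (s n) u)" and ?G = "\<lambda>u. \<phi> (g u)"
    have close: "\<bar>?F u - ?G u\<bar> \<le> e" if "norm u = 1" for u
      using d(2)[OF ran[OF that] gran[OF that]] elim(3) that by (simp add: less_imp_le)
    have "\<bar>integral\<^sup>L (M (s n)) ?F - integral\<^sup>L (M (s n)) ?G\<bar> \<le> e * measure (M (s n)) (sphere 0 1)"
      by (intro integral_uniform_close M comp fc ran g(1) gran close)
    also have "\<dots> \<le> e * m" using elim(1) e by (intro mult_left_mono) auto
    finally have 1: "\<bar>integral\<^sup>L (M (s n)) ?F - integral\<^sup>L (M (s n)) ?G\<bar> \<le> \<epsilon> / 4"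
      using m0 by (simp add: e_def)
    have "\<bar>integral\<^sup>L N ?F - integral\<^sup>L N ?G\<bar> \<le> e * measure N (sphere 0 1)"
      by (intro integral_uniform_close N comp fc ran g(1) gran close)
    also have "\<dots> \<le> e * m" using e by (intro mult_left_mono) (auto simp: m_def)
    finally have 2: "\<bar>integral\<^sup>L N ?F - integral\<^sup>L N ?G\<bar> \<le> \<epsilon> / 4"
      using m0 by (simp add: e_def)
    from 1 2 elim(2) sX[of n, unfolded X_def] \<epsilon>(1) show False by linarith
  qed
  then show False by simp
qed


section \<open>Comparing two bodies\<close>

lemma sphere_set_le:
  fixes f g :: "'a::euclidean_space \<Rightarrow> real"
  assumes "continuous_on (sphere 0 1) f" "continuous_on (sphere 0 1) g"
  shows "{u \<in> sphere 0 1. f u \<le> g u} \<in> sets sphere_borel"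
proof -
  have [measurable]: "f \<in> borel_measurable sphere_borel" "g \<in> borel_measurable sphere_borel"
    using assms by (auto intro: borel_measurable_continuous_on_restrict)
  have "{u \<in> space sphere_borel. f u \<le> g u} \<in> sets sphere_borel" by measurable
  then show ?thesis by (simp add: space_restrict_space)
qed

lemma sphere_indicator_integral:
  fixes E :: "'a::euclidean_space set"
  assumes "E \<in> sets sphere_borel"
  shows "integrable sphere_lebesgue (\<lambda>u. k * indicator E u :: real)"
    and "(\<integral>u. k * indicator E u \<partial>sphere_lebesgue) = k * measure sphere_lebesgue E"
proof -
  interpret finite_measure "sphere_lebesgue :: 'a measure" by (rule finite_sphere_lebesgue)
  have E: "E \<in> sets sphere_lebesgue" by (rule sphere_borel_sets_lebesgue[OF assms])
  then show "integrable sphere_lebesgue (\<lambda>u. k * indicator E u :: real)"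
    by (intro integrable_mult_right integrable_real_indicator) (auto simp: emeasure_eq_measure)
  have "E \<inter> sphere 0 1 = E" using sets.sets_into_space[OF E] by auto
  then show "(\<integral>u. k * indicator E u \<partial>sphere_lebesgue) = k * measure sphere_lebesgue E" by simp
qed

lemma continuous_sphere_positive_lower_bound:
  fixes f :: "'a::euclidean_space \<Rightarrow> real"
  assumes "continuous_on (sphere 0 1) f" "\<And>u. norm u = 1 \<Longrightarrow> 0 < f u"
  obtains d where "0 < d" "\<And>u. norm u = 1 \<Longrightarrow> d \<le> f u"
proof -
  have "sphere (0::'a) 1 \<noteq> {}" by simp
  then obtain z where "z \<in> sphere 0 1" "\<And>u. u \<in> sphere 0 1 \<Longrightarrow> f z \<le> f u"
    using continuous_attains_inf[OF compact_sphere _ assms(1)] by blast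
  then show thesis using assms(2)[of z] by (intro that[of "f z"]) auto
qed

lemma dual_density_pos:
  fixes K Q :: "'a::euclidean_space set"
  assumes "K \<in> convex_bodies_o" "Q \<in> star_bodies_o" "norm u = 1"
  shows "0 < dual_density q K Q u"
  using radial_fun_pos_convex[OF assms(1,3)] radial_fun_pos_star[OF assms(2,3)]
  by (simp add: dual_density_def)

lemma inner_gauss_map_pos:
  fixes K :: "'a::euclidean_space set"
  assumes K: "K \<in> convex_bodies_o" and u: "norm u = 1"
  shows "0 < u \<bullet> gauss_map K u"
  using gauss_map_support[OF K u] support_fun_pos[OF K norm_gauss_map[OF K u]]
    radial_fun_pos_convex[OF K u] by (metis zero_less_mult_pos)

lemma integral_support_powr_self:
  fixes K Q :: "'a::euclidean_space set"
  assumes K: "K \<in> convex_bodies_o" and Q: "Q \<in> star_bodies_o"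
  shows "(\<integral>v. support_fun K v powr p \<partial>Lp_dual_curvature_measure p q K Q) =
    (\<integral>u. dual_density q K Q u \<partial>sphere_lebesgue)"
  unfolding integral_Lp_dual_curvature_measure[OF K Q support_powr_continuous[OF K]]
proof (rule Bochner_Integration.integral_cong[OF refl])
  fix u :: 'a assume "u \<in> space sphere_lebesgue"
  then have "0 < support_fun K (gauss_map K u)"
    using support_fun_pos[OF K norm_gauss_map[OF K]] by simp
  then have "support_fun K (gauss_map K u) powr (- p) * support_fun K (gauss_map K u) powr p = 1"
    by (simp add: powr_minus)
  then show "dual_density q K Q u * (support_fun K (gauss_map K u) powr (- p) * support_fun K (gauss_map K u) powr p)
      = dual_density q K Q u" by simp
qed

text \<open>At \<open>v = \<alpha>\<^sub>K(u)\<close> the identity \<open>h\<^sub>K(v) = \<rho>\<^sub>K(u) (u \<bullet> v)\<close> holds, while for \<open>L\<close> the right-hand side is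
  only a lower bound of \<open>h\<^sub>L(v)\<close>.\<close>

lemma support_ratio_ge_radial_ratio:
  fixes K L :: "'a::euclidean_space set"
  assumes K: "K \<in> convex_bodies_o" and L: "L \<in> convex_bodies_o" and u: "norm u = 1" and p: "0 \<le> p"
  shows "(radial_fun L u / radial_fun K u) powr p \<le>
    support_fun K (gauss_map K u) powr (- p) * support_fun L (gauss_map K u) powr p"
proof -
  let ?v = "gauss_map K u"
  note pos = inner_gauss_map_pos[OF K u] radial_fun_pos_convex[OF K u] radial_fun_pos_convex[OF L u]
  have hK: "support_fun K ?v = radial_fun K u * (u \<bullet> ?v)" using gauss_map_support[OF K u] by simp
  have hL: "radial_fun L u * (u \<bullet> ?v) \<le> support_fun L ?v" by (rule radial_inner_le_support[OF L u])
  have "radial_fun L u / radial_fun K u = radial_fun L u * (u \<bullet> ?v) / support_fun K ?v"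
    using pos by (simp add: hK)
  also have "\<dots> \<le> support_fun L ?v / support_fun K ?v"
    using hL pos by (intro divide_right_mono) (simp_all add: hK)
  finally have "(radial_fun L u / radial_fun K u) powr p \<le> (support_fun L ?v / support_fun K ?v) powr p"
    using pos p by (intro powr_mono2) auto
  also have "\<dots> = support_fun K ?v powr (- p) * support_fun L ?v powr p"
    using support_fun_pos[OF K norm_gauss_map[OF K u]] support_fun_pos[OF L norm_gauss_map[OF K u]]
    by (simp add: powr_divide powr_minus field_simps)
  finally show ?thesis .
qed

lemma radial_ratio_continuous:
  fixes K L :: "'a::euclidean_space set"
  assumes K: "K \<in> convex_bodies_o" and L: "L \<in> convex_bodies_o"
  shows "continuous_on (sphere 0 1) (\<lambda>u. (radial_fun L u / radial_fun K u) powr a)"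
  using radial_fun_pos_convex[OF K] radial_fun_pos_convex[OF L]
  by (intro continuous_intros radial_fun_continuous K L) (auto simp: less_imp_neq[symmetric])

lemma integral_support_powr_mixed:
  fixes K L Q :: "'a::euclidean_space set"
  assumes K: "K \<in> convex_bodies_o" and L: "L \<in> convex_bodies_o" and Q: "Q \<in> star_bodies_o" and p: "0 \<le> p"
  shows "(\<integral>u. dual_density q K Q u * (radial_fun L u / radial_fun K u) powr p \<partial>sphere_lebesgue) \<le>
    (\<integral>v. support_fun L v powr p \<partial>Lp_dual_curvature_measure p q K Q)"
  unfolding integral_Lp_dual_curvature_measure[OF K Q support_powr_continuous[OF L]]
proof (rule integral_mono)
  show "integrable sphere_lebesgue (\<lambda>u. dual_density q K Q u * (radial_fun L u / radial_fun K u) powr p)"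
    by (intro continuous_sphere_integrable continuous_intros dual_density_continuous radial_ratio_continuous K L Q)
  show "integrable sphere_lebesgue (\<lambda>u. dual_density q K Q u *
      (support_fun K (gauss_map K u) powr (- p) * support_fun L (gauss_map K u) powr p))"
    by (intro gauss_map_integrable[OF K, of _ "\<lambda>v. support_fun K v powr (- p) * support_fun L v powr p"]
        continuous_intros dual_density_continuous support_powr_continuous K L Q)
  show "dual_density q K Q u * (radial_fun L u / radial_fun K u) powr p \<le>
      dual_density q K Q u * (support_fun K (gauss_map K u) powr (- p) * support_fun L (gauss_map K u) powr p)"
    if "u \<in> space sphere_lebesgue" for u
    using that p by (intro mult_left_mono support_ratio_ge_radial_ratio K L dual_density_nonneg) auto
qed

text \<open>For \<open>p > 0\<close> and \<open>q < p\<close> both factors change sign at \<open>t = 1\<close> only, and in the same sense.\<close>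

definition ratio_gap :: "real \<Rightarrow> real \<Rightarrow> real \<Rightarrow> real" where
  "ratio_gap p q t = (t powr p - 1) * (1 - t powr (q - p))"

lemma ratio_gap_nonneg:
  assumes "0 < p" "q < p" "0 < t"
  shows "0 \<le> ratio_gap p q t"
proof (cases "1 \<le> t")
  case True
  have "1 \<le> t powr p" using True assms by (simp add: ge_one_powr_ge_zero)
  moreover have "t powr (q - p) \<le> t powr 0" using True assms by (intro powr_mono) auto
  ultimately show ?thesis using True by (simp add: ratio_gap_def)
next
  case False
  have "t powr p \<le> 1" using False assms by (intro powr_le1) auto
  moreover have "t powr 0 \<le> t powr (q - p)" using False assms by (intro powr_mono') auto
  ultimately show ?thesis using assms by (simp add: ratio_gap_def mult_nonpos_nonpos)
qed

lemma ratio_gap_pos: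
  assumes "0 < p" "q < p" "0 < c" "c \<noteq> 1"
  shows "0 < ratio_gap p q c"
proof -
  have "c powr p \<noteq> 1" "c powr (q - p) \<noteq> 1" using assms by (simp_all add: powr_eq_one_iff_gen)
  then have "ratio_gap p q c \<noteq> 0" by (simp add: ratio_gap_def)
  with ratio_gap_nonneg[OF assms(1-3)] show ?thesis by simp
qed

lemma ratio_gap_mono:
  assumes pq: "0 < p" "q < p" and "0 < c" "0 < t"
    and t: "(c \<le> 1 \<and> t \<le> c) \<or> (1 \<le> c \<and> c \<le> t)"
  shows "ratio_gap p q c \<le> ratio_gap p q t"
  using t
proof
  assume h: "c \<le> 1 \<and> t \<le> c"
  have "t powr p \<le> c powr p" "c powr p \<le> 1" using h assms by (auto intro!: powr_mono2 powr_le1)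
  moreover have "c powr (q - p) \<le> t powr (q - p)" "1 \<le> c powr (q - p)"
    using h assms powr_mono2'[of "q - p" t c] powr_mono'[of "q - p" 0 c] by auto
  ultimately have "(1 - c powr p) * (c powr (q - p) - 1) \<le> (1 - t powr p) * (t powr (q - p) - 1)"
    by (intro mult_mono) auto
  then show ?thesis by (simp add: ratio_gap_def algebra_simps)
next
  assume h: "1 \<le> c \<and> c \<le> t"
  have "c powr p \<le> t powr p" "1 \<le> c powr p" using h assms by (auto intro!: powr_mono2 ge_one_powr_ge_zero)
  moreover have "t powr (q - p) \<le> c powr (q - p)" "c powr (q - p) \<le> 1"
    using h assms powr_mono2'[of "q - p" c t] powr_mono[of "q - p" 0 c] by auto
  ultimately show ?thesis unfolding ratio_gap_def by (intro mult_mono) auto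
qed

text \<open>The expansion \<open>(t\<^sup>p - 1)(1 - t\<^sup>q\<^sup>-\<^sup>p) = (t\<^sup>p - 1) + t\<^sup>q (t\<^sup>-\<^sup>p - 1)\<close> with \<open>t = \<rho>\<^sub>L / \<rho>\<^sub>K\<close> splits the
  integrand into a term for \<open>(K, L)\<close> and the same term for \<open>(L, K)\<close>. Each is bounded with
  \<open>integral_support_powr_mixed\<close>.\<close>

lemma integral_ratio_gap_le:
  fixes K L Q :: "'a::euclidean_space set"
  assumes K: "K \<in> convex_bodies_o" and L: "L \<in> convex_bodies_o" and Q: "Q \<in> star_bodies_o" and p: "0 \<le> p"
  shows "(\<integral>u. dual_density q K Q u * ratio_gap p q (radial_fun L u / radial_fun K u) \<partial>sphere_lebesgue) \<le>
    ((\<integral>v. support_fun L v powr p \<partial>Lp_dual_curvature_measure p q K Q)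
      - (\<integral>v. support_fun L v powr p \<partial>Lp_dual_curvature_measure p q L Q))
    + ((\<integral>v. support_fun K v powr p \<partial>Lp_dual_curvature_measure p q L Q)
      - (\<integral>v. support_fun K v powr p \<partial>Lp_dual_curvature_measure p q K Q))"
proof -
  have eq: "dual_density q K Q u * ratio_gap p q (radial_fun L u / radial_fun K u) =
      (dual_density q K Q u * (radial_fun L u / radial_fun K u) powr p - dual_density q K Q u)
      + (dual_density q L Q u * (radial_fun K u / radial_fun L u) powr p - dual_density q L Q u)"
    if u: "norm u = 1" for u
  proof -
    define a b where "a = radial_fun K u" and "b = radial_fun L u"
    define w where "w = radial_fun Q u powr (real DIM('a) - q) / real DIM('a)"
    have a: "0 < a" and b: "0 < b"
      using radial_fun_pos_convex[OF K u] radial_fun_pos_convex[OF L u] by (auto simp: a_def b_def)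
    have D: "dual_density q K Q u = a powr q * w" "dual_density q L Q u = b powr q * w"
      by (simp_all add: dual_density_def a_def b_def w_def)
    have 1: "b powr q = a powr q * (b / a) powr q" using a b by (simp add: powr_divide)
    have 2: "b powr q * (a / b) powr p = a powr q * (b / a) powr (q - p)"
      using a b by (simp add: powr_divide powr_diff field_simps)
    have 3: "(b / a) powr p * (b / a) powr (q - p) = (b / a) powr q"
      by (simp flip: powr_add)
    have "a powr q * w * ratio_gap p q (b / a)
        = a powr q * w * ((b / a) powr p - 1) + w * (a powr q * (b / a) powr (q - p))
          - w * (a powr q * ((b / a) powr p * (b / a) powr (q - p)))"
      by (simp add: ratio_gap_def algebra_simps)
    also have "\<dots> = a powr q * w * ((b / a) powr p - 1) + w * (b powr q * (a / b) powr p) - w * b powr q"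
      by (simp only: 2 3 1[symmetric])
    finally show ?thesis unfolding D a_def[symmetric] b_def[symmetric] by (simp add: algebra_simps)
  qed
  have int: "integrable sphere_lebesgue (dual_density q A Q)"
    "integrable sphere_lebesgue (\<lambda>u. dual_density q A Q u * (radial_fun B u / radial_fun A u) powr p)"
    if "A \<in> convex_bodies_o" "B \<in> convex_bodies_o" for A B
    by (intro continuous_sphere_integrable continuous_intros dual_density_continuous radial_ratio_continuous that Q)+
  have "(\<integral>u. dual_density q K Q u * ratio_gap p q (radial_fun L u / radial_fun K u) \<partial>sphere_lebesgue)
      = (\<integral>u. (dual_density q K Q u * (radial_fun L u / radial_fun K u) powr p - dual_density q K Q u)
      + (dual_density q L Q u * (radial_fun K u / radial_fun L u) powr p - dual_density q L Q u) \<partial>sphere_lebesgue)"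
    by (intro Bochner_Integration.integral_cong refl eq) simp
  also have "\<dots> = ((\<integral>u. dual_density q K Q u * (radial_fun L u / radial_fun K u) powr p \<partial>sphere_lebesgue)
        - (\<integral>u. dual_density q K Q u \<partial>sphere_lebesgue))
      + ((\<integral>u. dual_density q L Q u * (radial_fun K u / radial_fun L u) powr p \<partial>sphere_lebesgue)
        - (\<integral>u. dual_density q L Q u \<partial>sphere_lebesgue))"
    using int[OF K L] int[OF L K] by simp
  finally show ?thesis
    using integral_support_powr_mixed[OF K L Q p, of q] integral_support_powr_mixed[OF L K Q p, of q]
    by (simp add: integral_support_powr_self[OF K Q] integral_support_powr_self[OF L Q])
qed

text \<open>A Chebyshev estimate: where the ratio is beyond \<open>c\<close>, on the side away from 1, the integrand is
  bounded below by a positive constant, so this set of directions eventually has smaller measure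
  than the directions of any ball in question.\<close>

lemma ratio_rarely_far_from_one:
  fixes K Q :: "'a::euclidean_space set" and L :: "nat \<Rightarrow> 'a set"
  assumes K: "K \<in> convex_bodies_o" and L: "\<And>i. L i \<in> convex_bodies_o" and Q: "Q \<in> star_bodies_o"
    and pq: "0 < p" "q < p"
    and lim: "(\<lambda>i. \<integral>u. dual_density q K Q u * ratio_gap p q (radial_fun (L i) u / radial_fun K u) \<partial>sphere_lebesgue) \<longlonglongrightarrow> 0"
    and c: "0 < c" "c \<noteq> 1" and R: "0 < R" "0 < \<delta>"
  shows "\<forall>\<^sub>F i in sequentially. \<forall>z. norm z \<le> R \<longrightarrow>
    \<not> (\<forall>y\<in>ball z \<delta>. y \<noteq> 0 \<longrightarrow>
        (if c < 1 then radial_fun (L i) (y /\<^sub>R norm y) \<le> c * radial_fun K (y /\<^sub>R norm y)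
         else c * radial_fun K (y /\<^sub>R norm y) \<le> radial_fun (L i) (y /\<^sub>R norm y)))"
proof -
  obtain m where m: "0 < m" "\<And>(E::'a set) z. E \<in> sets sphere_borel \<Longrightarrow> norm z \<le> R \<Longrightarrow>
       (\<And>y. y \<in> ball z \<delta> \<Longrightarrow> y \<noteq> 0 \<Longrightarrow> y /\<^sub>R norm y \<in> E) \<Longrightarrow> m \<le> measure sphere_lebesgue E"
    using sphere_measure_directions_of_ball[OF R] by blast
  obtain d where d: "0 < d" "\<And>u. norm u = 1 \<Longrightarrow> d \<le> dual_density q K Q u"
    using continuous_sphere_positive_lower_bound[OF dual_density_continuous[OF K Q] dual_density_pos[OF K Q]]
    by blast
  let ?k = "ratio_gap p q c"
  have k: "0 < ?k" by (rule ratio_gap_pos[OF pq c])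
  have "\<forall>\<^sub>F i in sequentially. (\<integral>u. dual_density q K Q u * ratio_gap p q (radial_fun (L i) u / radial_fun K u) \<partial>sphere_lebesgue) < d * ?k * m"
    using lim by (rule order_tendstoD) (use d k m in auto)
  then show ?thesis
  proof eventually_elim
    case (elim i)
    let ?g = "\<lambda>u. dual_density q K Q u * ratio_gap p q (radial_fun (L i) u / radial_fun K u)"
    let ?P = "\<lambda>u. if c < 1 then radial_fun (L i) u \<le> c * radial_fun K u else c * radial_fun K u \<le> radial_fun (L i) u"
    let ?E = "{u \<in> sphere 0 1. ?P u}"
    have cont: "continuous_on (sphere 0 1) (radial_fun (L i))"
      "continuous_on (sphere 0 1) (\<lambda>u. c * radial_fun K u)"
      by (intro continuous_intros radial_fun_continuous K L)+
    have E: "?E \<in> sets sphere_borel"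
      using sphere_set_le[OF cont] sphere_set_le[OF cont(2,1)] by (cases "c < 1") auto
    have gint: "integrable sphere_lebesgue ?g"
      unfolding ratio_gap_def
      by (intro continuous_sphere_integrable continuous_intros dual_density_continuous radial_ratio_continuous K L Q)
    have "(\<integral>u. d * ?k * indicator ?E u \<partial>sphere_lebesgue) \<le> integral\<^sup>L sphere_lebesgue ?g"
    proof (rule integral_mono)
      show "integrable sphere_lebesgue (\<lambda>u. d * ?k * indicator ?E u)"
        by (rule sphere_indicator_integral(1)[OF E])
      show "d * ?k * indicator ?E u \<le> ?g u" if "u \<in> space sphere_lebesgue" for u
      proof -
        have u: "norm u = 1" using that by simp
        let ?t = "radial_fun (L i) u / radial_fun K u"
        have pos: "0 < radial_fun K u" "0 < radial_fun (L i) u"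
          using radial_fun_pos_convex[OF _ u] K L by auto
        then have t: "0 < ?t" by simp
        have D: "d \<le> dual_density q K Q u" by (rule d(2)[OF u])
        show ?thesis
        proof (cases "u \<in> ?E")
          case True
          then have "(c \<le> 1 \<and> ?t \<le> c) \<or> (1 \<le> c \<and> c \<le> ?t)"
            using pos by (auto simp: field_simps split: if_splits)
          then have "?k \<le> ratio_gap p q ?t" by (rule ratio_gap_mono[OF pq c(1) t])
          then have "d * ?k \<le> ?g u" using D d(1) k by (intro mult_mono) auto
          with True show ?thesis by simp
        next
          case False
          then show ?thesis
            using mult_nonneg_nonneg[OF dual_density_nonneg ratio_gap_nonneg[OF pq t]] by simp
        qed
      qed
    qed (rule gint)
    also have "(\<integral>u. d * ?k * indicator ?E u \<partial>sphere_lebesgue) = d * ?k * measure sphere_lebesgue ?E"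
      by (rule sphere_indicator_integral(2)[OF E])
    finally have "d * ?k * measure sphere_lebesgue ?E < d * ?k * m" using elim by linarith
    then have lt: "measure sphere_lebesgue ?E < m" using d k by simp
    show ?case
    proof (intro allI impI notI)
      fix z :: 'a assume z: "norm z \<le> R" and *: "\<forall>y\<in>ball z \<delta>. y \<noteq> 0 \<longrightarrow> ?P (y /\<^sub>R norm y)"
      have "m \<le> measure sphere_lebesgue ?E"
        by (rule m(2)[OF E z]) (use * in auto)
      with lt show False by simp
    qed
  qed
qed

lemma shrunk_ball_subset:
  fixes K :: "'a::euclidean_space set"
  assumes "convex K" "x \<in> K" "cball 0 r \<subseteq> K" "0 < l" "l \<le> 1"
  shows "ball ((1 - l) *\<^sub>R x) (l * r) \<subseteq> K"
proof
  fix y assume y: "y \<in> ball ((1 - l) *\<^sub>R x) (l * r)"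
  define b where "b = (y - (1 - l) *\<^sub>R x) /\<^sub>R l"
  have "norm b = norm (y - (1 - l) *\<^sub>R x) / l"
    unfolding b_def norm_scaleR using assms(4) by (simp add: divide_inverse mult.commute)
  also have "\<dots> \<le> r" using y assms(4) by (simp add: dist_norm norm_minus_commute pos_divide_le_eq mult.commute)
  finally have "norm b \<le> r" .
  then have "(1 - l) *\<^sub>R x + l *\<^sub>R b \<in> K"
    using assms by (intro convexD) auto
  then show "y \<in> K" using assms(4) by (simp add: b_def)
qed


section \<open>A common bound for the bodies\<close>

lemma ball_direction_close:
  fixes w y :: "'a::euclidean_space"
  assumes "norm w = 1" "y \<in> ball w \<delta>" "y \<noteq> 0"
  shows "norm (y /\<^sub>R norm y - w) \<le> 2 * \<delta>"
proof -
  have yw: "norm (y - w) < \<delta>" using assms(2) by (simp add: dist_norm norm_minus_commute)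
  have "y /\<^sub>R norm y - y = (1 / norm y - 1) *\<^sub>R y" by (simp add: algebra_simps divide_inverse)
  then have "norm (y /\<^sub>R norm y - y) = \<bar>1 / norm y - 1\<bar> * \<bar>norm y\<bar>" by simp
  also have "\<dots> = \<bar>1 - norm y\<bar>"
    unfolding abs_mult[symmetric] using assms(3) by (simp add: left_diff_distrib)
  also have "\<dots> \<le> norm (y - w)" using norm_triangle_ineq3[of y w] assms(1) by simp
  finally show ?thesis using yw norm_triangle_ineq[of "y /\<^sub>R norm y - y" "y - w"] by simp
qed

text \<open>For \<open>u\<close> near \<open>w\<close> the normal \<open>v = \<alpha>\<^sub>K(u)\<close> satisfies \<open>w \<bullet> v \<ge> r / (2 R)\<close>, because
  \<open>u \<bullet> v = h\<^sub>K(v) / \<rho>\<^sub>K(u) \<ge> r / R\<close>. These \<open>u\<close> alone give a lower bound uniform in \<open>w\<close>.\<close>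

lemma Lp_dual_curvature_not_in_hemisphere:
  fixes K Q :: "'a::euclidean_space set"
  assumes K: "K \<in> convex_bodies_o" and Q: "Q \<in> star_bodies_o" and p: "0 < p"
  obtains c where "0 < c"
    "\<And>w. norm w = 1 \<Longrightarrow> c \<le> (\<integral>v. max 0 (w \<bullet> v) powr p \<partial>Lp_dual_curvature_measure p q K Q)"
proof -
  obtain r R where rR: "0 < r" "r \<le> R" "cball 0 r \<subseteq> K" "K \<subseteq> cball 0 R"
    using convex_bodies_o_radii[OF K] by blast
  note KD = convex_bodies_oD[OF K]
  have R: "0 < R" using rR by simp
  \<comment> \<open>Directions of points within this distance of w are within twice that distance of w.\<close>
  define \<delta> where "\<delta> = r / (4 * R)"
  have \<delta>: "0 < \<delta>" using rR R by (simp add: \<delta>_def)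
  obtain m where m: "0 < m" "\<And>(E::'a set) z. E \<in> sets sphere_borel \<Longrightarrow> norm z \<le> 1 \<Longrightarrow>
       (\<And>y. y \<in> ball z \<delta> \<Longrightarrow> y \<noteq> 0 \<Longrightarrow> y /\<^sub>R norm y \<in> E) \<Longrightarrow> m \<le> measure sphere_lebesgue E"
    using sphere_measure_directions_of_ball[OF zero_less_one \<delta>] by blast
  obtain d where d: "0 < d" "\<And>u. norm u = 1 \<Longrightarrow> d \<le> dual_density q K Q u"
    using continuous_sphere_positive_lower_bound[OF dual_density_continuous[OF K Q] dual_density_pos[OF K Q]]
    by blast
  define k where "k = d * (R powr (- p) * (r / (2 * R)) powr p)"
  have k: "0 < k" using d rR R by (simp add: k_def)
  show thesis
  proof (rule that[of "k * m"])
    show "0 < k * m" using k m by simp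
    fix w :: 'a assume w: "norm w = 1"
    let ?E = "{u \<in> sphere 0 1. norm (u - w) \<le> r / (2 * R)}"
    have E: "?E \<in> sets sphere_borel" by (intro sphere_set_le continuous_intros)
    let ?f = "\<lambda>v. max 0 (w \<bullet> v) powr p"
    have fc: "continuous_on (sphere 0 1) ?f"
      by (intro continuous_on_powr' continuous_intros) (use p in auto)
    let ?g = "\<lambda>u. dual_density q K Q u * (support_fun K (gauss_map K u) powr (- p) * ?f (gauss_map K u))"
    have gint: "integrable sphere_lebesgue ?g"
      by (intro gauss_map_integrable[OF K, of _ "\<lambda>v. support_fun K v powr (- p) * ?f v"]
        continuous_on_mult dual_density_continuous support_powr_continuous fc K Q)
    have "m \<le> measure sphere_lebesgue ?E"
    proof (rule m(2)[OF E])
      fix y assume "y \<in> ball w \<delta>" "y \<noteq> 0"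
      from ball_direction_close[OF w this] show "y /\<^sub>R norm y \<in> ?E"
        using \<open>y \<noteq> 0\<close> by (simp add: \<delta>_def)
    qed (use w in simp)
    then have "k * m \<le> k * measure sphere_lebesgue ?E" using k by simp
    also have "\<dots> = (\<integral>u. k * indicator ?E u \<partial>sphere_lebesgue)"
      by (rule sphere_indicator_integral(2)[OF E, symmetric])
    also have "\<dots> \<le> integral\<^sup>L sphere_lebesgue ?g"
    proof (rule integral_mono)
      show "integrable sphere_lebesgue (\<lambda>u. k * indicator ?E u)"
        by (rule sphere_indicator_integral(1)[OF E])
      show "k * indicator ?E u \<le> ?g u" if "u \<in> space sphere_lebesgue" for u
      proof (cases "u \<in> ?E")
        case True
        have u: "norm u = 1" using that by simp
        let ?v = "gauss_map K u"
        have v: "norm ?v = 1" by (rule norm_gauss_map[OF K u])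
        have h: "0 < support_fun K ?v" "r \<le> support_fun K ?v" "support_fun K ?v \<le> R"
          using support_fun_pos[OF K v] support_fun_lower[OF rR(3) KD(3), of ?v]
            support_fun_upper[OF rR(4) KD(5), of ?v] rR(1) v by auto
        have "r \<le> radial_fun K u * (u \<bullet> ?v)" using gauss_map_support[OF K u] h by simp
        also have "\<dots> \<le> R * (u \<bullet> ?v)"
          using radial_fun_upper_bound[OF rR(4) KD(4,1) u] inner_gauss_map_pos[OF K u]
          by (intro mult_right_mono) auto
        finally have "r / R \<le> u \<bullet> ?v" using R by (simp add: field_simps)
        moreover have "(u - w) \<bullet> ?v \<le> r / (2 * R)"
          using norm_cauchy_schwarz[of "u - w" ?v] v True by simp
        ultimately have "r / (2 * R) \<le> w \<bullet> ?v" by (simp add: inner_diff_left field_simps)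
        then have "(r / (2 * R)) powr p \<le> ?f ?v" using p rR R by (intro powr_mono2) auto
        moreover have "R powr (- p) \<le> support_fun K ?v powr (- p)"
          using h p by (intro powr_mono2') auto
        ultimately have "R powr (- p) * (r / (2 * R)) powr p \<le> support_fun K ?v powr (- p) * ?f ?v"
          by (intro mult_mono) auto
        then have "k \<le> ?g u" unfolding k_def
            by (rule mult_mono[OF d(2)[OF u]]) (use d(2)[OF u] d(1) in auto)
        with True show ?thesis by simp
      next
        case False
        have "0 \<le> ?g u" by (intro mult_nonneg_nonneg dual_density_nonneg) auto
        with False show ?thesis by simp
      qed
    qed (rule gint)
    also have "\<dots> = (\<integral>v. ?f v \<partial>Lp_dual_curvature_measure p q K Q)"
      by (rule integral_Lp_dual_curvature_measure[OF K Q fc, symmetric])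
    finally show "k * m \<le> (\<integral>v. ?f v \<partial>Lp_dual_curvature_measure p q K Q)" .
  qed
qed

text \<open>Both sides are compared with the integral of \<open>h\<^sub>K\<^sup>p\<close>, which equals that of \<open>\<rho>\<^sub>K\<^sup>q d\<nu>\<close>: from below
  through \<open>h\<^sub>K(v) \<ge> v \<bullet> x\<close>, from above through \<open>\<rho>\<^sub>K \<le> norm x\<close>, where \<open>q \<ge> 0\<close> enters.\<close>

lemma farthest_point_radius_bound:
  fixes K Q :: "'a::euclidean_space set"
  assumes K: "K \<in> convex_bodies_o" and Q: "Q \<in> star_bodies_o" and p: "0 < p" and q: "0 \<le> q"
    and x: "x \<in> K" "0 < norm x" "\<And>y. y \<in> K \<Longrightarrow> norm y \<le> norm x"
  shows "norm x powr p * (\<integral>v. max 0 ((x /\<^sub>R norm x) \<bullet> v) powr p \<partial>Lp_dual_curvature_measure p q K Q)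
    \<le> norm x powr q * (\<integral>u. radial_fun Q u powr (real DIM('a) - q) / real DIM('a) \<partial>sphere_lebesgue)"
proof -
  let ?R = "norm x" and ?w = "x /\<^sub>R norm x" and ?M = "Lp_dual_curvature_measure p q K Q"
  note KD = convex_bodies_oD[OF K]
  have sub: "K \<subseteq> cball 0 ?R" using x(3) by auto
  let ?f = "\<lambda>v. max 0 (?w \<bullet> v) powr p"
  have fc: "continuous_on (sphere 0 1) ?f"
    by (intro continuous_on_powr' continuous_intros) (use p in auto)
  note intM = integrable_sphere_continuous[OF sets_Lp_dual_curvature_measure(1)[OF K Q] finite_Lp_dual_curvature_measure[OF K Q]]
  have "?R powr p * integral\<^sup>L ?M ?f = (\<integral>v. ?R powr p * ?f v \<partial>?M)" by simp
  also have "\<dots> \<le> (\<integral>v. support_fun K v powr p \<partial>?M)"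
  proof (intro integral_mono integrable_mult_right intM fc support_powr_continuous[OF K])
    fix v assume "v \<in> space ?M"
    then have v: "norm v = 1" by (simp add: sets_Lp_dual_curvature_measure(2)[OF K Q])
    have "?R * max 0 (?w \<bullet> v) \<le> support_fun K v"
      using support_fun_ge[OF KD(3) x(1), of v] support_fun_pos[OF K v] x(2)
      by (auto simp: max_def inner_commute field_simps)
    then have "(?R * max 0 (?w \<bullet> v)) powr p \<le> support_fun K v powr p"
      using p by (intro powr_mono2) auto
    then show "?R powr p * ?f v \<le> support_fun K v powr p" by (simp add: powr_mult)
  qed
  also have "\<dots> = (\<integral>u. dual_density q K Q u \<partial>sphere_lebesgue)" by (rule integral_support_powr_self[OF K Q])
  also have "\<dots> \<le> (\<integral>u. ?R powr q * (radial_fun Q u powr (real DIM('a) - q) / real DIM('a)) \<partial>sphere_lebesgue)"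
  proof (intro integral_mono continuous_sphere_integrable continuous_on_mult continuous_on_divide
      continuous_on_const dual_density_continuous star_powr_continuous K Q)
    fix u :: 'a assume "u \<in> space sphere_lebesgue"
    then have u: "norm u = 1" by simp
    have "radial_fun K u powr q \<le> ?R powr q"
      using radial_fun_upper_bound[OF sub KD(4,1) u] radial_fun_pos_convex[OF K u] q
      by (intro powr_mono2) auto
    then show "dual_density q K Q u \<le> ?R powr q * (radial_fun Q u powr (real DIM('a) - q) / real DIM('a))"
      unfolding dual_density_def times_divide_eq_right by (intro divide_right_mono mult_right_mono) auto
  qed simp
  finally show ?thesis by simp
qed

text \<open>Apply \<open>farthest_point_radius_bound\<close> to a farthest point of each body. The functions
  \<open>max 0 (w \<bullet> v)\<^sup>p\<close> for unit vectors \<open>w\<close> are equicontinuous, so their integrals against the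
  measures of the sequence eventually inherit a positive lower bound from the limit measure. As
  \<open>q < p\<close>, the resulting inequality between powers of the radius bounds the radius.\<close>

lemma weak_convergence_bounded:
  fixes L :: "nat \<Rightarrow> 'a::euclidean_space set"
  assumes p: "0 < p" and q: "0 \<le> q" "q < p" and Q: "Q \<in> star_bodies_o"
    and K: "K \<in> convex_bodies_o" and L: "\<And>i. L i \<in> convex_bodies_o"
    and wc: "sphere_weakly_converges (\<lambda>i. Lp_dual_curvature_measure p q (L i) Q) (Lp_dual_curvature_measure p q K Q)"
  obtains R where "0 < R" "\<And>i. L i \<subseteq> cball 0 R"
proof -
  let ?M = "\<lambda>i. Lp_dual_curvature_measure p q (L i) Q" and ?N = "Lp_dual_curvature_measure p q K Q"
  have "\<exists>x. x \<in> L i \<and> 0 < norm x \<and> (\<forall>y\<in>L i. norm y \<le> norm x)" for i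
  proof -
    note LD = convex_bodies_oD[OF L[of i]]
    obtain x where x: "x \<in> L i" "\<And>y. y \<in> L i \<Longrightarrow> norm y \<le> norm x"
      using continuous_attains_sup[OF LD(1,5), of norm] continuous_on_norm_id by blast
    obtain r R where rR: "0 < r" "r \<le> R" "cball 0 r \<subseteq> L i" "L i \<subseteq> cball 0 R"
      using convex_bodies_o_radii[OF L[of i]] by blast
    obtain b :: 'a where "norm b = r" using vector_choose_size[of r] rR(1) by auto
    then have "r \<le> norm x" using x(2)[of b] rR(3) by (auto simp: subset_iff)
    then show ?thesis using x rR(1) by (intro exI[of _ x]) auto
  qed
  then obtain x where x: "\<And>i. x i \<in> L i" "\<And>i. 0 < norm (x i)" "\<And>i y. y \<in> L i \<Longrightarrow> norm y \<le> norm (x i)"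
    by metis
  define f where "f = (\<lambda>i v. max 0 ((x i /\<^sub>R norm (x i)) \<bullet> v))"
  have nx: "norm (x i /\<^sub>R norm (x i)) = 1" for i using x(2)[of i] by simp
  have lip: "\<bar>f i u - f i v\<bar> \<le> 1 * norm (u - v)" for i u v
  proof -
    have "\<bar>f i u - f i v\<bar> \<le> \<bar>(x i /\<^sub>R norm (x i)) \<bullet> (u - v)\<bar>"
      unfolding f_def inner_diff_right by linarith
    also have "\<dots> \<le> 1 * norm (u - v)" using Cauchy_Schwarz_ineq2[of "x i /\<^sub>R norm (x i)" "u - v"] unfolding nx .
    finally show ?thesis .
  qed
  have ran: "f i u \<in> {0..1}" if "norm u = 1" for i u
    using norm_cauchy_schwarz[of "x i /\<^sub>R norm (x i)" u] that unfolding nx f_def by simp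
  have pc: "continuous_on {0..1} (\<lambda>t::real. t powr p)"
    by (intro continuous_on_powr' continuous_intros) (use p in auto)
  obtain c where c: "0 < c" "\<And>w. norm w = 1 \<Longrightarrow> c \<le> (\<integral>v. max 0 (w \<bullet> v) powr p \<partial>?N)"
    using Lp_dual_curvature_not_in_hemisphere[OF K Q p] by blast
  have "(\<lambda>i. (\<integral>u. f i u powr p \<partial>?M i) - (\<integral>u. f i u powr p \<partial>?N)) \<longlonglongrightarrow> 0"
    by (rule weak_convergence_equicontinuous[OF wc _ _ _ _ lip ran pc])
      (simp_all add: sets_Lp_dual_curvature_measure finite_Lp_dual_curvature_measure K L Q)
  then have "\<forall>\<^sub>F i in sequentially. - (c / 2) < (\<integral>u. f i u powr p \<partial>?M i) - (\<integral>u. f i u powr p \<partial>?N)"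
    by (rule order_tendstoD) (use c in simp)
  then obtain n0 where n0: "\<And>i. i \<ge> n0 \<Longrightarrow> c / 2 \<le> (\<integral>u. f i u powr p \<partial>?M i)"
    using c(2)[OF nx] unfolding eventually_sequentially f_def by (smt (verit, best) field_sum_of_halves)
  define C where "C = (\<integral>u. radial_fun Q u powr (real DIM('a) - q) / real DIM('a) \<partial>sphere_lebesgue)"
  \<comment> \<open>Dividing the radius bound by the q-th power leaves an upper bound on the (p - q)-th power.\<close>
  define B where "B = (2 * C / c) powr (1 / (p - q))"
  have B: "norm (x i) \<le> B" if i: "i \<ge> n0" for i
  proof -
    let ?r = "norm (x i)"
    have "?r powr p * (\<integral>u. f i u powr p \<partial>?M i) \<le> ?r powr q * C"
      unfolding f_def C_def by (rule farthest_point_radius_bound[OF L Q p q(1) x])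
    moreover have "?r powr p * (c / 2) \<le> ?r powr p * (\<integral>u. f i u powr p \<partial>?M i)"
      using n0[OF i] by (intro mult_left_mono) auto
    ultimately have "?r powr p * (c / 2) \<le> ?r powr q * C" by linarith
    moreover have "?r powr p = ?r powr q * ?r powr (p - q)" by (simp flip: powr_add)
    ultimately have "?r powr q * (?r powr (p - q) * (c / 2)) \<le> ?r powr q * C" by (simp add: mult.assoc)
    then have "?r powr (p - q) * (c / 2) \<le> C" using x(2)[of i] by simp
    then have "?r powr (p - q) \<le> 2 * C / c" using c(1) by (simp add: field_simps)
    then have "(?r powr (p - q)) powr (1 / (p - q)) \<le> B"
      unfolding B_def using q by (intro powr_mono2) auto
    then show ?thesis using q x(2)[of i] by (simp add: powr_powr)
  qed
  define R where "R = 1 + B + (\<Sum>i<n0. norm (x i))"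
  have "norm (x i) \<le> R" for i
  proof (cases "i < n0")
    case True
    then have "norm (x i) \<le> (\<Sum>i<n0. norm (x i))" by (intro member_le_sum) auto
    then show ?thesis by (simp add: R_def B_def add_increasing)
  next
    case False
    then show ?thesis using B[of i] by (simp add: R_def add_increasing2 sum_nonneg)
  qed
  moreover have "0 < R" by (simp add: R_def B_def add_pos_nonneg sum_nonneg)
  ultimately show thesis using order_trans[OF x(3)] by (intro that[of R]) auto
qed

section \<open>Convergence of the bodies\<close>

lemma ratio_gap_integral_tendsto_zero:
  fixes L :: "nat \<Rightarrow> 'a::euclidean_space set"
  assumes p: "0 < p" and q: "q < p" and Q: "Q \<in> star_bodies_o"
    and K: "K \<in> convex_bodies_o" and L: "\<And>i. L i \<in> convex_bodies_o"
    and wc: "sphere_weakly_converges (\<lambda>i. Lp_dual_curvature_measure p q (L i) Q) (Lp_dual_curvature_measure p q K Q)"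
    and R: "\<And>i. L i \<subseteq> cball 0 R"
  shows "(\<lambda>i. \<integral>u. dual_density q K Q u * ratio_gap p q (radial_fun (L i) u / radial_fun K u) \<partial>sphere_lebesgue)
    \<longlonglongrightarrow> 0"
proof -
  let ?M = "\<lambda>i. Lp_dual_curvature_measure p q (L i) Q" and ?N = "Lp_dual_curvature_measure p q K Q"
  have ran: "support_fun (L i) u \<in> {0..R}" if "norm u = 1" for i u
    using support_fun_upper[OF R convex_bodies_oD(5)[OF L], of i u] support_fun_pos[OF L that, of i] that by simp
  have pc: "continuous_on {0..R} (\<lambda>t::real. t powr p)"
    by (intro continuous_on_powr' continuous_intros) (use p in auto)
  have "(\<lambda>i. (\<integral>u. support_fun (L i) u powr p \<partial>?M i) - (\<integral>u. support_fun (L i) u powr p \<partial>?N)) \<longlonglongrightarrow> 0"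
    by (rule weak_convergence_equicontinuous[OF wc _ _ _ _ support_fun_lipschitz[OF R convex_bodies_oD(5)[OF L]] ran pc])
      (simp_all add: sets_Lp_dual_curvature_measure finite_Lp_dual_curvature_measure K L Q)
  moreover have "(\<lambda>i. (\<integral>u. support_fun K u powr p \<partial>?M i)) \<longlonglongrightarrow> (\<integral>u. support_fun K u powr p \<partial>?N)"
    using wc support_powr_continuous[OF K] unfolding sphere_weakly_converges_def by blast
  ultimately have lim: "(\<lambda>i. - ((\<integral>u. support_fun (L i) u powr p \<partial>?M i) - (\<integral>u. support_fun (L i) u powr p \<partial>?N))
      + ((\<integral>u. support_fun K u powr p \<partial>?M i) - (\<integral>u. support_fun K u powr p \<partial>?N)))
      \<longlonglongrightarrow> - 0 + ((\<integral>u. support_fun K u powr p \<partial>?N) - (\<integral>u. support_fun K u powr p \<partial>?N))"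
    by (intro tendsto_intros)
  show ?thesis
  proof (rule tendsto_sandwich[OF _ _ tendsto_const])
    show "\<forall>\<^sub>F i in sequentially. 0 \<le> (\<integral>u. dual_density q K Q u * ratio_gap p q (radial_fun (L i) u / radial_fun K u) \<partial>sphere_lebesgue)"
    proof (intro always_eventually allI Bochner_Integration.integral_nonneg mult_nonneg_nonneg dual_density_nonneg ratio_gap_nonneg p q)
      fix i and u :: 'a assume "u \<in> space sphere_lebesgue"
      then show "0 < radial_fun (L i) u / radial_fun K u"
        using radial_fun_pos_convex[OF L, of u] radial_fun_pos_convex[OF K, of u] by simp
    qed
    show "\<forall>\<^sub>F i in sequentially. (\<integral>u. dual_density q K Q u * ratio_gap p q (radial_fun (L i) u / radial_fun K u) \<partial>sphere_lebesgue)
      \<le> - ((\<integral>u. support_fun (L i) u powr p \<partial>?M i) - (\<integral>u. support_fun (L i) u powr p \<partial>?N))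
      + ((\<integral>u. support_fun K u powr p \<partial>?M i) - (\<integral>u. support_fun K u powr p \<partial>?N))"
      using integral_ratio_gap_le[OF K L Q less_imp_le[OF p], of q] by (intro always_eventually allI) simp
  qed (use lim in simp)
qed

text \<open>Suppose \<open>h\<^sub>L(v) < (1 - e) h\<^sub>K(v)\<close>, and let \<open>x\<close> be a point of \<open>K\<close> farthest in direction \<open>v\<close>. Pulling
  \<open>x\<close> slightly towards the origin gives the centre of a ball in \<open>K\<close> all of whose points have height
  at least \<open>(1 - 3e/4) h\<^sub>K(v)\<close>. In each of its directions \<open>L\<close> ends, already because of its height in
  direction \<open>v\<close>, before \<open>c = (1 - e) / (1 - 3e/4)\<close> times the radius of \<open>K\<close>.\<close>

lemma eventually_support_ge:
  fixes L :: "nat \<Rightarrow> 'a::euclidean_space set"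
  assumes pq: "0 < p" "q < p" and Q: "Q \<in> star_bodies_o"
    and K: "K \<in> convex_bodies_o" and L: "\<And>i. L i \<in> convex_bodies_o"
    and lim: "(\<lambda>i. \<integral>u. dual_density q K Q u * ratio_gap p q (radial_fun (L i) u / radial_fun K u) \<partial>sphere_lebesgue) \<longlonglongrightarrow> 0"
    and e: "0 < e" "e < 1"
  shows "\<forall>\<^sub>F i in sequentially. \<forall>v. norm v = 1 \<longrightarrow> (1 - e) * support_fun K v \<le> support_fun (L i) v"
proof -
  obtain r R where rR: "0 < r" "r \<le> R" "cball 0 r \<subseteq> K" "K \<subseteq> cball 0 R"
    using convex_bodies_o_radii[OF K] by blast
  note KD = convex_bodies_oD[OF K]
  define c where "c = (1 - e) / (1 - 3 * e / 4)"
  have c: "0 < c" "c < 1" "c \<noteq> 1" "(1 - e) = c * (1 - 3 * e / 4)" using e by (auto simp: c_def field_simps)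
  have "0 < R" "0 < e * r / 4" using rR e by auto
  from ratio_rarely_far_from_one[OF K L Q pq lim c(1,3) this]
  show ?thesis
  proof eventually_elim
    case (elim i)
    show ?case
    proof (intro allI impI, rule ccontr)
      fix v :: 'a assume v: "norm v = 1" and "\<not> (1 - e) * support_fun K v \<le> support_fun (L i) v"
      then have lt: "support_fun (L i) v < (1 - e) * support_fun K v" by simp
      obtain x where x: "x \<in> K" "support_fun K v = v \<bullet> x" using support_fun_attained[OF KD(1,5)] by blast
      let ?h = "support_fun K v"
      have h: "r \<le> ?h" using support_fun_lower[OF rR(3) KD(3), of v] rR(1) v by simp
      define z where "z = (1 - e / 2) *\<^sub>R x"
      have nx: "norm x \<le> R" using x(1) rR(4) by auto
      have "norm z = (1 - e / 2) * norm x" using e by (simp add: z_def)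
      also have "\<dots> \<le> 1 * norm x" using e by (intro mult_right_mono) auto
      finally have zR: "norm z \<le> R" using nx by simp
      have sub: "ball z (e / 2 * r) \<subseteq> K"
        unfolding z_def using KD(2) x(1) rR(3) by (rule shrunk_ball_subset) (use e in auto)
      have "radial_fun (L i) (y /\<^sub>R norm y) \<le> c * radial_fun K (y /\<^sub>R norm y)"
        if y: "y \<in> ball z (e * r / 4)" "y \<noteq> 0" for y
      proof -
        define u where "u = y /\<^sub>R norm y"
        have u: "norm u = 1" "y = norm y *\<^sub>R u" using y(2) by (auto simp: u_def)
        have "e * r / 4 \<le> e / 2 * r" using e rR(1) by (simp add: field_simps)
        with y(1) have "y \<in> ball z (e / 2 * r)" by (auto intro: less_le_trans)
        then have "norm y *\<^sub>R u \<in> K" using sub u(2) by auto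
        then have su: "norm y \<le> radial_fun K u"
          using u(1) by (intro radial_fun_upper[OF KD(1,4)]) auto
        have "norm (z - y) < e * r / 4" using y(1) by (simp add: dist_norm)
        then have "v \<bullet> (z - y) \<le> e * r / 4" using norm_cauchy_schwarz[of v "z - y"] v by simp
        also have "\<dots> \<le> e * ?h / 4" using h e by simp
        finally have yv: "(1 - 3 * e / 4) * ?h \<le> v \<bullet> y"
          by (simp add: z_def x(2)[symmetric] inner_diff_right field_simps)
        have ypos: "0 < (1 - 3 * e / 4) * ?h" using e h rR(1) by (intro mult_pos_pos) auto
        have "norm y * (u \<bullet> v) = v \<bullet> y" by (subst (2) u(2)) (simp add: inner_commute)
        then have uv: "0 < norm y * (u \<bullet> v)" using yv ypos by linarith
        then have uv0: "0 < u \<bullet> v" by (simp add: zero_less_mult_iff y(2))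
        have "radial_fun (L i) u * (u \<bullet> v) \<le> support_fun (L i) v" by (rule radial_inner_le_support[OF L u(1)])
        also have "\<dots> \<le> c * ((1 - 3 * e / 4) * ?h)" using lt c(4) by simp
        also have "\<dots> \<le> c * (norm y * (u \<bullet> v))"
          using yv c(1) \<open>norm y * (u \<bullet> v) = v \<bullet> y\<close> by (intro mult_left_mono) auto
        finally have "radial_fun (L i) u * (u \<bullet> v) \<le> c * norm y * (u \<bullet> v)" by simp
        then have "radial_fun (L i) u \<le> c * norm y" using uv0 by simp
        also have "\<dots> \<le> c * radial_fun K u" using su c(1) by (intro mult_left_mono) auto
        finally show ?thesis by (simp add: u_def)
      qed
      then show False using elim zR c(2) by auto
    qed
  qed
qed

text \<open>The argument of \<open>eventually_support_ge\<close> with the roles of \<open>K\<close> and \<open>L\<close> exchanged. It needs a ball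
  about the origin inside all late bodies of the sequence, of radius \<open>r / 2\<close>, which
  \<open>eventually_support_ge\<close> itself provides.\<close>

lemma eventually_support_le:
  fixes L :: "nat \<Rightarrow> 'a::euclidean_space set"
  assumes pq: "0 < p" "q < p" and Q: "Q \<in> star_bodies_o"
    and K: "K \<in> convex_bodies_o" and L: "\<And>i. L i \<in> convex_bodies_o"
    and lim: "(\<lambda>i. \<integral>u. dual_density q K Q u * ratio_gap p q (radial_fun (L i) u / radial_fun K u) \<partial>sphere_lebesgue) \<longlonglongrightarrow> 0"
    and R: "0 < R" "\<And>i. L i \<subseteq> cball 0 R" and e: "0 < e" "e < 1"
  shows "\<forall>\<^sub>F i in sequentially. \<forall>v. norm v = 1 \<longrightarrow> support_fun (L i) v \<le> (1 + e) * support_fun K v"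
proof -
  obtain r R' where rR': "0 < r" "r \<le> R'" "cball 0 r \<subseteq> K" "K \<subseteq> cball 0 R'"
    using convex_bodies_o_radii[OF K] by blast
  note KD = convex_bodies_oD[OF K]
  \<comment> \<open>Contracting a point of L by the factor 1 - \<eta> loses at most half of the excess height e * r, ball radius included.\<close>
  define \<eta> where "\<eta> = e * r / 2 / (R + r)"
  have \<eta>: "0 < \<eta>" "\<eta> \<le> 1" "\<eta> * (R + r) = e * r / 2"
  proof -
    have "R + r \<noteq> 0" using rR'(1) R(1) by simp
    then show "\<eta> * (R + r) = e * r / 2" by (metis \<eta>_def nonzero_eq_divide_eq)
    show "0 < \<eta>" using rR' R e by (simp add: \<eta>_def)
    have "e * r \<le> 1 * r" using e rR'(1) by (intro mult_right_mono) auto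
    then have "e * r / 2 \<le> R + r" using R(1) rR'(1) by linarith
    then show "\<eta> \<le> 1" using R(1) rR'(1) by (simp add: \<eta>_def pos_divide_le_eq del: divide_divide_eq_left)
  qed
  define c where "c = 1 + e / 2"
  have c: "0 < c" "c \<noteq> 1" "\<not> c < 1" using e by (auto simp: c_def)
  have "0 < \<eta> * (r / 2)" using \<eta>(1) rR'(1) by simp
  note far = ratio_rarely_far_from_one[OF K L Q pq lim c(1,2) R(1) this]
  have "\<forall>\<^sub>F i in sequentially. \<forall>v. norm v = 1 \<longrightarrow> (1 - 1/2) * support_fun K v \<le> support_fun (L i) v"
    by (rule eventually_support_ge[OF pq Q K L lim]) auto
  with far show ?thesis
  proof eventually_elim
    case (elim i)
    note LD = convex_bodies_oD[OF L[of i]]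
    \<comment> \<open>If h is at least r/2 on the sphere, so is the radial function, by its value at a normal.\<close>
    have inner_ball: "cball 0 (r / 2) \<subseteq> L i"
    proof
      fix y :: 'a assume y: "y \<in> cball 0 (r / 2)"
      show "y \<in> L i"
      proof (cases "y = 0")
        case True
        then show ?thesis using LD(4) by simp
      next
        case False
        define u where "u = y /\<^sub>R norm y"
        have u: "norm u = 1" "y = norm y *\<^sub>R u" using False by (auto simp: u_def)
        let ?v = "gauss_map (L i) u" and ?\<rho> = "radial_fun (L i) u"
        note v = norm_gauss_map[OF L u(1), of i]
        have "r / 2 \<le> (1 - 1/2) * support_fun K ?v"
          using support_fun_lower[OF rR'(3) KD(3), of ?v] rR'(1) v by simp
        also have "\<dots> \<le> support_fun (L i) ?v" using elim(2) v by blast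
        also have "\<dots> = ?\<rho> * (u \<bullet> ?v)" by (rule gauss_map_support[OF L u(1), symmetric])
        also have "\<dots> \<le> ?\<rho> * 1"
          using norm_cauchy_schwarz[of u ?v] u(1) v radial_fun_pos_convex[OF L u(1), of i]
          by (intro mult_left_mono) auto
        finally have le: "norm y \<le> ?\<rho>" using y by simp
        have mem: "?\<rho> *\<^sub>R u \<in> L i" by (rule radial_fun_mem[OF LD(1,4)]) (use u in auto)
        have pos: "0 < ?\<rho>" by (rule radial_fun_pos_convex[OF L u(1)])
        have "(1 - norm y / ?\<rho>) *\<^sub>R 0 + (norm y / ?\<rho>) *\<^sub>R (?\<rho> *\<^sub>R u) \<in> L i"
          using le pos by (intro convexD[OF LD(2) LD(4) mem]) auto
        then show ?thesis using pos u(2) by simp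
      qed
    qed
    show ?case
    proof (intro allI impI, rule ccontr)
      fix v :: 'a assume v: "norm v = 1" and "\<not> support_fun (L i) v \<le> (1 + e) * support_fun K v"
      then have lt: "(1 + e) * support_fun K v < support_fun (L i) v" by simp
      obtain x where x: "x \<in> L i" "support_fun (L i) v = v \<bullet> x" using support_fun_attained[OF LD(1,5)] by blast
      let ?h = "support_fun K v"
      have h: "r \<le> ?h" using support_fun_lower[OF rR'(3) KD(3), of v] rR'(1) v by simp
      define z where "z = (1 - \<eta>) *\<^sub>R x"
      have nx: "norm x \<le> R" using x(1) R(2)[of i] by auto
      have "norm z = (1 - \<eta>) * norm x" using \<eta> by (simp add: z_def)
      also have "\<dots> \<le> 1 * norm x" using \<eta> by (intro mult_right_mono) auto
      finally have zR: "norm z \<le> R" using nx by simp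
      have sub: "ball z (\<eta> * (r / 2)) \<subseteq> L i"
        unfolding z_def by (rule shrunk_ball_subset[OF LD(2) x(1) inner_ball \<eta>(1,2)])
      have vx: "v \<bullet> x \<le> R" using norm_cauchy_schwarz[of v x] v nx by simp
      have "c * radial_fun K (y /\<^sub>R norm y) \<le> radial_fun (L i) (y /\<^sub>R norm y)"
        if y: "y \<in> ball z (\<eta> * (r / 2))" "y \<noteq> 0" for y
      proof -
        define u where "u = y /\<^sub>R norm y"
        have u: "norm u = 1" "y = norm y *\<^sub>R u" using y(2) by (auto simp: u_def)
        have "norm y *\<^sub>R u \<in> L i" using sub y(1) u(2) by auto
        then have su: "norm y \<le> radial_fun (L i) u"
          using u(1) by (intro radial_fun_upper[OF LD(1,4)]) auto
        have "norm (z - y) < \<eta> * (r / 2)" using y(1) by (simp add: dist_norm)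
        then have 1: "v \<bullet> (z - y) \<le> \<eta> * (r / 2)" using norm_cauchy_schwarz[of v "z - y"] v by simp
        have 2: "v \<bullet> z = v \<bullet> x - \<eta> * (v \<bullet> x)" by (simp add: z_def algebra_simps)
        have 3: "\<eta> * (v \<bullet> x) \<le> \<eta> * R" using vx \<eta>(1) by (intro mult_left_mono) auto
        have 4: "\<eta> * R + \<eta> * (r / 2) \<le> e * r / 2"
          using \<eta>(3) mult_pos_pos[OF \<eta>(1) rR'(1)] by (simp add: algebra_simps)
        have 5: "e * r \<le> e * ?h" using h e(1) by simp
        have yv: "c * ?h \<le> v \<bullet> y"
          using 1 2 3 4 5 lt unfolding x(2) inner_diff_right c_def by (simp add: algebra_simps)
        have uvy: "norm y * (u \<bullet> v) = v \<bullet> y" by (subst (2) u(2)) (simp add: inner_commute)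
        have "0 < c * ?h" using c(1) h rR'(1) by (intro mult_pos_pos) auto
        then have uv: "0 < norm y * (u \<bullet> v)" using yv uvy by linarith
        then have uv0: "0 < u \<bullet> v" by (simp add: zero_less_mult_iff y(2))
        have "c * (radial_fun K u * (u \<bullet> v)) \<le> c * ?h"
          using radial_inner_le_support[OF K u(1), of v] c(1) by (intro mult_left_mono) auto
        also have "\<dots> \<le> norm y * (u \<bullet> v)" using yv uvy by simp
        finally have "c * radial_fun K u * (u \<bullet> v) \<le> norm y * (u \<bullet> v)" by (simp add: mult.assoc)
        then have "c * radial_fun K u \<le> norm y" using uv0 by simp
        also note su
        finally show ?thesis by (simp add: u_def)
      qed
      then show False using elim(1) zR c(3) by auto
    qed
  qed
qed

theorem theorem1p3:
  fixes p q :: real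
    and Q :: "'a::euclidean_space set"
    and K :: "nat \<Rightarrow> 'a set"
  assumes "p \<ge> 1" and "0 \<le> q" and "q < p"
    and "Q \<in> star_bodies_o"
    and "\<And>i. K i \<in> convex_bodies_o"
    and "sphere_weakly_converges (\<lambda>i. Lp_dual_curvature_measure p q (K (Suc i)) Q)
           (Lp_dual_curvature_measure p q (K 0) Q)"
  shows "(\<lambda>i. hausdorff_distance (K (Suc i)) (K 0)) \<longlonglongrightarrow> 0"
proof -
  have p: "0 < p" using assms(1) by simp
  note K = assms(5)
  obtain R where R: "0 < R" "\<And>i. K (Suc i) \<subseteq> cball 0 R"
    using weak_convergence_bounded[OF p assms(2-4) K K assms(6)] by blast
  have lim: "(\<lambda>i. \<integral>u. dual_density q (K 0) Q u * ratio_gap p q (radial_fun (K (Suc i)) u / radial_fun (K 0) u) \<partial>sphere_lebesgue)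
    \<longlonglongrightarrow> 0"
    by (rule ratio_gap_integral_tendsto_zero[OF p assms(3,4) K K assms(6) R(2)])
  note near = eventually_support_ge[OF p assms(3,4) K K lim] eventually_support_le[OF p assms(3,4) K K lim R]
  obtain R0 where R0: "0 < R0" "K 0 \<subseteq> cball 0 R0"
    using inside_large_cball[OF convex_bodies_oD(3)[OF K]] by blast
  show ?thesis
  proof (rule tendstoI)
    fix d :: real assume d: "0 < d"
    define e where "e = min (1/2) (d / (2 * R0))"
    have e: "0 < e" "e < 1" "e * R0 \<le> d / 2"
    proof -
      have "e * R0 \<le> d / (2 * R0) * R0" using R0 by (intro mult_right_mono) (auto simp: e_def)
      then show "e * R0 \<le> d / 2" using R0 by simp
    qed (use d R0 in \<open>auto simp: e_def\<close>)
    from near(1)[OF e(1,2)] near(2)[OF e(1,2)]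
    show "\<forall>\<^sub>F i in sequentially. dist (hausdorff_distance (K (Suc i)) (K 0)) 0 < d"
    proof eventually_elim
      case (elim i)
      let ?D = "\<lambda>u. \<bar>support_fun (K (Suc i)) u - support_fun (K 0) u\<bar>"
      have le: "?D u \<le> d / 2" if u: "u \<in> sphere 0 1" for u
      proof -
        have "e * support_fun (K 0) u \<le> e * R0"
          using support_fun_upper[OF R0(2) convex_bodies_oD(5)[OF K], of u] u e(1) by (intro mult_left_mono) auto
        moreover have "(1 - e) * support_fun (K 0) u \<le> support_fun (K (Suc i)) u"
          "support_fun (K (Suc i)) u \<le> (1 + e) * support_fun (K 0) u" using elim u by auto
        ultimately show ?thesis using e(3)
          unfolding abs_le_iff left_diff_distrib distrib_right by linarith
      qed
      have ne: "sphere (0::'a) 1 \<noteq> {}" by simp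
      then obtain u :: 'a where u: "u \<in> sphere 0 1" by blast
      have "hausdorff_distance (K (Suc i)) (K 0) \<le> d / 2"
        unfolding hausdorff_distance_def using le by (intro cSUP_least[OF ne])
      moreover have "?D u \<le> hausdorff_distance (K (Suc i)) (K 0)"
        unfolding hausdorff_distance_def using le by (intro cSUP_upper[OF u] bdd_aboveI2[where M = "d / 2"])
      ultimately show ?case using d by simp
    qed
  qed
qed


end
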